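(* Let $0\le a<b\le1$ and let $\varphi\in C^2(a,b)$ be nonnegative, with $\lim_{s\downarrow a}\varphi(s)=+\infty=\lim_{s\uparrow b}\varphi(s)$, and strongly convex with parameter $\xi>0$: $(\varphi'(s_1)-\varphi'(s_2))(s_1-s_2)\ge\xi|s_1-s_2|^2$ for all $s_1,s_2\in(a,b)$. If $\|\mathsf f\|_{L^2(\Omega)}$ and $\|\mathsf u_d\|_{L^2(\Omega)}$ are sufficiently small (i.e. there is $\varepsilon>0$, depending only on $\Omega,a,b,\varphi$, such that the following holds whenever $\mathsf f,\mathsf u_d\in L^2(\Omega)$ have norms at most $\varepsilon$), then for every optimal $\bar s\in(a,b)$ (i.e. $f(\bar s)\le f(s)$ for all $s\in(a,b)$) there exist $\vartheta>0$ with $f''(\bar s)\ge\vartheta$ and $\delta>0$ such that, for all $s\in(a,b)\cap(\bar s-\delta,\bar s+\delta)$, $$(f'(s)-f'(\bar s))(s-\bar s)\ge\frac{\vartheta}{2}|s-\bar s|^2$$ and $$f(s)\ge f(\bar s)+\frac{\vartheta}{4}|s-\bar s|^2 .$$ In particular, $f$ has a local minimum at $\bar s$, and this minimum is unique in $(\bar s-\delta,\bar s+\delta)\cap(a,b)$.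
   Context: $\Omega\subset\mathbb R^n$ ($n\ge1$) is an open, bounded, convex polytopal domain. $\{(\lambda_k,\varphi_k)\}_{k\in\mathbb N}$ are the eigenpairs of the Dirichlet Laplacian on $\Omega$ with $\{\varphi_k\}$ an orthonormal basis of $L^2(\Omega)$ (not to be confused with the function $\varphi$); $\mathsf f_k=(\mathsf f,\varphi_k)_{L^2(\Omega)}$. The control to state map is $\mathcal S(s)=\sum_k\lambda_k^{-s}\mathsf f_k\varphi_k$, $s\in(0,1)$, i.e. $\mathcal S(s)$ solves the spectral fractional equation $(-\Delta)^s\mathsf u=\mathsf f$; it is three times differentiable from $(0,1)$ to $L^2(\Omega)$. The reduced cost is $f(s)=\frac12\|\mathcal S(s)-\mathsf u_d\|^2_{L^2(\Omega)}+\varphi(s)$, $s\in(a,b)$; it is of class $C^2(a,b)$. *)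

theory Defs
  imports "HOL-Analysis.Analysis"
begin

definition convex_polytopal_domain :: "'a::euclidean_space set \<Rightarrow> bool" where
  "convex_polytopal_domain \<Omega> \<longleftrightarrow>
     open \<Omega> \<and> \<Omega> \<noteq> {} \<and> bounded \<Omega> \<and> convex \<Omega> \<and> polytope (closure \<Omega>)"


text \<open>Elements of \<open>L\<^sup>2(\<Omega>)\<close> are represented by functions on the whole space; only the values on
  \<open>\<Omega>\<close> matter, and these up to null sets.  The codomain is \<open>real\<close> for scalar functions (where
  \<open>\<bullet>\<close> is multiplication) and \<open>'a\<close> for gradient fields.\<close>

definition L2 :: "'a::euclidean_space set \<Rightarrow> ('a \<Rightarrow> 'b::euclidean_space) set" where
  "L2 \<Omega> = {u \<in> borel_measurable (lebesgue_on \<Omega>).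
              integrable (lebesgue_on \<Omega>) (\<lambda>x. (norm (u x))\<^sup>2)}"

definition L2_inner ::
    "'a::euclidean_space set \<Rightarrow> ('a \<Rightarrow> 'b::euclidean_space) \<Rightarrow> ('a \<Rightarrow> 'b) \<Rightarrow> real" where
  "L2_inner \<Omega> u v = (LINT x|lebesgue_on \<Omega>. u x \<bullet> v x)"

definition L2_norm :: "'a::euclidean_space set \<Rightarrow> ('a \<Rightarrow> 'b::euclidean_space) \<Rightarrow> real" where
  "L2_norm \<Omega> u = sqrt (L2_inner \<Omega> u u)"

definition L2_sums ::
    "'a::euclidean_space set \<Rightarrow> (nat \<Rightarrow> 'a \<Rightarrow> real) \<Rightarrow> ('a \<Rightarrow> real) \<Rightarrow> bool" where
  "L2_sums \<Omega> v u \<longleftrightarrow>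
     u \<in> L2 \<Omega> \<and> (\<lambda>N. L2_norm \<Omega> (\<lambda>x. (\<Sum>k<N. v k x) - u x)) \<longlonglongrightarrow> 0"

definition orthonormal_basis_L2 ::
    "'a::euclidean_space set \<Rightarrow> (nat \<Rightarrow> 'a \<Rightarrow> real) \<Rightarrow> bool" where
  "orthonormal_basis_L2 \<Omega> e \<longleftrightarrow>
     (\<forall>k. e k \<in> L2 \<Omega>) \<and>
     (\<forall>j k. L2_inner \<Omega> (e j) (e k) = (if j = k then 1 else 0)) \<and>
     (\<forall>u\<in>L2 \<Omega>. L2_sums \<Omega> (\<lambda>k x. L2_inner \<Omega> u (e k) * e k x) u)"


primrec continuously_differentiable :: "nat \<Rightarrow> ('a::euclidean_space \<Rightarrow> real) \<Rightarrow> bool" where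
  "continuously_differentiable 0 \<psi> \<longleftrightarrow> continuous_on UNIV \<psi>"
| "continuously_differentiable (Suc m) \<psi> \<longleftrightarrow>
     (\<forall>x. \<psi> differentiable at x) \<and>
     (\<forall>b\<in>Basis. continuously_differentiable m (\<lambda>x. frechet_derivative \<psi> (at x) b))"

text \<open>The space \<open>C\<^sub>c\<^sup>\<infinity>(\<Omega>)\<close>, its elements being extended by zero outside \<open>\<Omega>\<close>.\<close>

definition test_functions :: "'a::euclidean_space set \<Rightarrow> ('a \<Rightarrow> real) set" where
  "test_functions \<Omega> = {\<psi>. (\<forall>m. continuously_differentiable m \<psi>) \<and>
      compact (closure {x. \<psi> x \<noteq> 0}) \<and> closure {x. \<psi> x \<noteq> 0} \<subseteq> \<Omega>}"

definition grad :: "('a::euclidean_space \<Rightarrow> real) \<Rightarrow> 'a \<Rightarrow> 'a" where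
  "grad \<psi> x = (\<Sum>b\<in>Basis. frechet_derivative \<psi> (at x) b *\<^sub>R b)"

definition is_weak_grad ::
    "'a::euclidean_space set \<Rightarrow> ('a \<Rightarrow> real) \<Rightarrow> ('a \<Rightarrow> 'a) \<Rightarrow> bool" where
  "is_weak_grad \<Omega> u g \<longleftrightarrow> g \<in> L2 \<Omega> \<and>
     (\<forall>\<psi>\<in>test_functions \<Omega>.
        (LINT x|lebesgue_on \<Omega>. u x *\<^sub>R grad \<psi> x) = - (LINT x|lebesgue_on \<Omega>. \<psi> x *\<^sub>R g x))"

definition H1 :: "'a::euclidean_space set \<Rightarrow> ('a \<Rightarrow> real) set" where
  "H1 \<Omega> = {u \<in> L2 \<Omega>. \<exists>g. is_weak_grad \<Omega> u g}"

text \<open>The weak gradient is unique up to null sets, so the choice is immaterial.\<close>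

definition weak_grad :: "'a::euclidean_space set \<Rightarrow> ('a \<Rightarrow> real) \<Rightarrow> 'a \<Rightarrow> 'a" where
  "weak_grad \<Omega> u = (SOME g. is_weak_grad \<Omega> u g)"

text \<open>\<open>H\<^sub>0\<^sup>1(\<Omega>)\<close> is the closure of the test functions in \<open>H\<^sup>1(\<Omega>)\<close>.\<close>

definition H10 :: "'a::euclidean_space set \<Rightarrow> ('a \<Rightarrow> real) set" where
  "H10 \<Omega> = {u \<in> H1 \<Omega>. \<exists>\<psi>. (\<forall>m::nat. \<psi> m \<in> test_functions \<Omega>) \<and>
      (\<lambda>m. L2_norm \<Omega> (\<lambda>x. \<psi> m x - u x)) \<longlonglongrightarrow> 0 \<and>
      (\<lambda>m. L2_norm \<Omega> (\<lambda>x. grad (\<psi> m) x - weak_grad \<Omega> u x)) \<longlonglongrightarrow> 0}"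

text \<open>Eigenpairs of the Dirichlet Laplacian: \<open>-\<Delta>w = \<mu>w\<close> in \<open>\<Omega>\<close>, \<open>w = 0\<close> on the boundary,
  in the usual weak sense.\<close>

definition dirichlet_eigenpair ::
    "'a::euclidean_space set \<Rightarrow> real \<Rightarrow> ('a \<Rightarrow> real) \<Rightarrow> bool" where
  "dirichlet_eigenpair \<Omega> \<mu> w \<longleftrightarrow>
     w \<in> H10 \<Omega> \<and> L2_norm \<Omega> w \<noteq> 0 \<and>
     (\<forall>v\<in>H10 \<Omega>. L2_inner \<Omega> (weak_grad \<Omega> w) (weak_grad \<Omega> v) = \<mu> * L2_inner \<Omega> w v)"

definition dirichlet_eigenbasis ::
    "'a::euclidean_space set \<Rightarrow> (nat \<Rightarrow> real) \<Rightarrow> (nat \<Rightarrow> 'a \<Rightarrow> real) \<Rightarrow> bool" where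
  "dirichlet_eigenbasis \<Omega> \<mu> e \<longleftrightarrow>
     (\<forall>k. dirichlet_eigenpair \<Omega> (\<mu> k) (e k)) \<and> orthonormal_basis_L2 \<Omega> e"


text \<open>The sum is an element of \<open>L\<^sup>2(\<Omega>)\<close>, hence determined only up to null sets; an arbitrary
  representative is chosen.\<close>

definition control_to_state ::
    "'a::euclidean_space set \<Rightarrow> (nat \<Rightarrow> real) \<Rightarrow> (nat \<Rightarrow> 'a \<Rightarrow> real) \<Rightarrow> ('a \<Rightarrow> real)
       \<Rightarrow> real \<Rightarrow> 'a \<Rightarrow> real" where
  "control_to_state \<Omega> \<mu> e f s =
     (SOME u. L2_sums \<Omega> (\<lambda>k x. \<mu> k powr (- s) * L2_inner \<Omega> f (e k) * e k x) u)"

definition reduced_cost ::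
    "'a::euclidean_space set \<Rightarrow> (nat \<Rightarrow> real) \<Rightarrow> (nat \<Rightarrow> 'a \<Rightarrow> real)
       \<Rightarrow> (real \<Rightarrow> real) \<Rightarrow> ('a \<Rightarrow> real) \<Rightarrow> ('a \<Rightarrow> real) \<Rightarrow> real \<Rightarrow> real" where
  "reduced_cost \<Omega> \<mu> e \<phi> f u\<^sub>d s =
     1/2 * (L2_norm \<Omega> (\<lambda>x. control_to_state \<Omega> \<mu> e f s x - u\<^sub>d x))\<^sup>2 + \<phi> s"


text \<open>Membership in \<open>C\<^sup>2(I)\<close> for an open set \<open>I\<close> of reals.\<close>

definition C2_on :: "real set \<Rightarrow> (real \<Rightarrow> real) \<Rightarrow> bool" where
  "C2_on I h \<longleftrightarrow>
     (\<forall>s\<in>I. h differentiable at s \<and> deriv h differentiable at s) \<and>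
     continuous_on I (deriv (deriv h))"

definition local_minimum_on :: "real set \<Rightarrow> (real \<Rightarrow> real) \<Rightarrow> real \<Rightarrow> bool" where
  "local_minimum_on I h t \<longleftrightarrow>
     t \<in> I \<and> (\<exists>\<eta>>0. \<forall>s\<in>I. \<bar>s - t\<bar> < \<eta> \<longrightarrow> h t \<le> h s)"

end

theory Submission
  imports Defs
begin

text \<open>By Parseval, the quadratic part of the reduced cost at \<open>s\<close> is
  \<open>1/2 * (\<Sum>k. f\<^sub>k\<^sup>2 * \<mu>\<^sub>k powr (- 2 * s)) - (\<Sum>k. f\<^sub>k * d\<^sub>k * \<mu>\<^sub>k powr (- s)) + 1/2 * (\<Sum>k. d\<^sub>k\<^sup>2)\<close>,
  where \<open>f\<^sub>k\<close> and \<open>d\<^sub>k\<close> are the Fourier coefficients of \<open>f\<close> and \<open>u\<^sub>d\<close>.  The Poincare inequality bounds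
  all \<open>\<mu>\<^sub>k\<close> below by a constant depending only on \<open>\<Omega>\<close>, so these series can be differentiated
  termwise for \<open>s > 0\<close>.  The second derivative of the first series is nonnegative; that of the second
  is of order \<open>\<epsilon>\<^sup>2\<close>, uniformly for \<open>s\<close> away from \<open>0\<close>.  Comparison with the midpoint of \<open>(a, b)\<close> and the
  blow-up of \<open>\<phi>\<close> at \<open>a\<close> keep every optimal \<open>t\<close> away from \<open>a \<ge> 0\<close>, so for small \<open>\<epsilon>\<close> the strong convexity
  of \<open>\<phi>\<close> yields second derivative at least \<open>\<xi>/2\<close> at \<open>t\<close>.\<close>

subsection \<open>The seminorm on square-integrable functions\<close>

lemma L2_integrable_norm_sq: "u \<in> L2 \<Omega> \<Longrightarrow> integrable (lebesgue_on \<Omega>) (\<lambda>x. (norm (u x))\<^sup>2)"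
  and L2_measurable: "u \<in> L2 \<Omega> \<Longrightarrow> u \<in> borel_measurable (lebesgue_on \<Omega>)"
  by (auto simp: L2_def)

lemma L2_inner_integrable:
  assumes "u \<in> L2 \<Omega>" "v \<in> L2 \<Omega>"
  shows "integrable (lebesgue_on \<Omega>) (\<lambda>x. u x \<bullet> v x)"
proof (rule Bochner_Integration.integrable_bound)
  show "integrable (lebesgue_on \<Omega>) (\<lambda>x. (norm (u x))\<^sup>2 + (norm (v x))\<^sup>2)"
    using assms by (intro Bochner_Integration.integrable_add L2_integrable_norm_sq)
  show "(\<lambda>x. u x \<bullet> v x) \<in> borel_measurable (lebesgue_on \<Omega>)"
    using assms by (intro borel_measurable_inner L2_measurable)
  show "AE x in lebesgue_on \<Omega>. norm (u x \<bullet> v x) \<le> norm ((norm (u x))\<^sup>2 + (norm (v x))\<^sup>2)"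
  proof (intro AE_I2)
    fix x
    have "\<bar>u x \<bullet> v x\<bar> \<le> norm (u x) * norm (v x)"
      by (rule Cauchy_Schwarz_ineq2)
    also have "\<dots> \<le> (norm (u x))\<^sup>2 + (norm (v x))\<^sup>2"
    proof -
      have "0 \<le> norm (u x) * norm (v x)"
        by simp
      then show ?thesis
        using sum_squares_bound[of "norm (u x)" "norm (v x)"] by linarith
    qed
    finally show "norm (u x \<bullet> v x) \<le> norm ((norm (u x))\<^sup>2 + (norm (v x))\<^sup>2)"
      by simp
  qed
qed

lemma L2_zero: "(\<lambda>x. 0) \<in> L2 \<Omega>"
  by (simp add: L2_def)

lemma L2_scaleR: "u \<in> L2 \<Omega> \<Longrightarrow> (\<lambda>x. c *\<^sub>R u x) \<in> L2 \<Omega>"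
  by (auto simp: L2_def power_mult_distrib)

lemma L2_add:
  assumes "u \<in> L2 \<Omega>" "v \<in> L2 \<Omega>"
  shows "(\<lambda>x. u x + v x) \<in> L2 \<Omega>"
proof -
  have "integrable (lebesgue_on \<Omega>) (\<lambda>x. (norm (u x))\<^sup>2 + 2 * (u x \<bullet> v x) + (norm (v x))\<^sup>2)"
    using assms by (intro Bochner_Integration.integrable_add integrable_mult_right
        L2_inner_integrable L2_integrable_norm_sq)
  moreover have "(norm (u x))\<^sup>2 + 2 * (u x \<bullet> v x) + (norm (v x))\<^sup>2 = (norm (u x + v x))\<^sup>2" for x
    by (simp add: power2_norm_eq_inner algebra_simps inner_commute)
  ultimately show ?thesis
    using assms by (auto simp: L2_def)
qed

lemma L2_diff: "u \<in> L2 \<Omega> \<Longrightarrow> v \<in> L2 \<Omega> \<Longrightarrow> (\<lambda>x. u x - v x) \<in> L2 \<Omega>"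
  using L2_add[of u \<Omega> "\<lambda>x. (-1) *\<^sub>R v x"] L2_scaleR[of v \<Omega> "-1"] by simp

lemma L2_sum: "(\<And>i. i \<in> I \<Longrightarrow> u i \<in> L2 \<Omega>) \<Longrightarrow> (\<lambda>x. \<Sum>i\<in>I. u i x) \<in> L2 \<Omega>"
  by (induction I rule: infinite_finite_induct) (auto intro: L2_add L2_zero)

lemma L2_inner_commute: "L2_inner \<Omega> u v = L2_inner \<Omega> v u"
  by (simp add: L2_inner_def inner_commute)

lemma L2_inner_add_left:
  "u \<in> L2 \<Omega> \<Longrightarrow> v \<in> L2 \<Omega> \<Longrightarrow> w \<in> L2 \<Omega> \<Longrightarrow>
    L2_inner \<Omega> (\<lambda>x. u x + v x) w = L2_inner \<Omega> u w + L2_inner \<Omega> v w"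
  by (simp add: L2_inner_def inner_add_left L2_inner_integrable)

lemma L2_inner_diff_left:
  "u \<in> L2 \<Omega> \<Longrightarrow> v \<in> L2 \<Omega> \<Longrightarrow> w \<in> L2 \<Omega> \<Longrightarrow>
    L2_inner \<Omega> (\<lambda>x. u x - v x) w = L2_inner \<Omega> u w - L2_inner \<Omega> v w"
  by (simp add: L2_inner_def inner_diff_left L2_inner_integrable)

lemma L2_inner_scaleR_left: "L2_inner \<Omega> (\<lambda>x. c *\<^sub>R u x) w = c * L2_inner \<Omega> u w"
  by (simp add: L2_inner_def)

lemma L2_inner_sum_left:
  assumes "\<And>i. i \<in> I \<Longrightarrow> u i \<in> L2 \<Omega>" "w \<in> L2 \<Omega>"
  shows "L2_inner \<Omega> (\<lambda>x. \<Sum>i\<in>I. u i x) w = (\<Sum>i\<in>I. L2_inner \<Omega> (u i) w)"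
  using assms
proof (induction I rule: infinite_finite_induct)
  case (insert i I)
  then show ?case
    by (simp add: L2_inner_add_left L2_sum)
qed (auto simp: L2_inner_def)

lemma L2_inner_nonneg: "0 \<le> L2_inner \<Omega> u u"
  by (simp add: L2_inner_def)

lemma L2_norm_nonneg: "0 \<le> L2_norm \<Omega> u"
  by (simp add: L2_norm_def L2_inner_nonneg)

lemma L2_norm_sq: "(L2_norm \<Omega> u)\<^sup>2 = L2_inner \<Omega> u u"
  by (simp add: L2_norm_def L2_inner_nonneg)

lemma nn_integral_norm_sq_eq_L2_norm:
  assumes "u \<in> L2 \<Omega>"
  shows "(\<integral>\<^sup>+x. ennreal ((norm (u x))\<^sup>2) \<partial>lebesgue_on \<Omega>) = ennreal ((L2_norm \<Omega> u)\<^sup>2)"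
  unfolding L2_norm_sq L2_inner_def power2_norm_eq_inner[symmetric]
  using L2_integrable_norm_sq[OF assms] by (intro nn_integral_eq_integral) auto

lemma L2_norm_minus_commute: "L2_norm \<Omega> (\<lambda>x. u x - v x) = L2_norm \<Omega> (\<lambda>x. v x - u x)"
  by (simp add: L2_norm_def L2_inner_def power2_norm_eq_inner[symmetric] norm_minus_commute)

text \<open>Bilinearity as a quadratic polynomial in \<open>t\<close>. Its nonnegativity yields
  Cauchy-Schwarz, \<open>t = 1\<close> the triangle inequality, and \<open>t = -1\<close> the
  expansion of the tracking term in the reduced cost.\<close>

lemma L2_inner_add_scaled:
  assumes "u \<in> L2 \<Omega>" "v \<in> L2 \<Omega>"
  shows "L2_inner \<Omega> (\<lambda>x. u x + t *\<^sub>R v x) (\<lambda>x. u x + t *\<^sub>R v x)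
    = L2_inner \<Omega> u u + 2 * t * L2_inner \<Omega> u v + t\<^sup>2 * L2_inner \<Omega> v v"
proof -
  have [simp]: "(\<lambda>x. t *\<^sub>R v x) \<in> L2 \<Omega>" "(\<lambda>x. u x + t *\<^sub>R v x) \<in> L2 \<Omega>"
    using assms by (auto intro: L2_scaleR L2_add)
  have *: "L2_inner \<Omega> (\<lambda>x. u x + t *\<^sub>R v x) w = L2_inner \<Omega> u w + t * L2_inner \<Omega> v w"
    if "w \<in> L2 \<Omega>" for w
    using assms that by (simp add: L2_inner_add_left L2_inner_scaleR_left)
  show ?thesis
    using *[of "\<lambda>x. u x + t *\<^sub>R v x"] *[OF assms(1)] *[OF assms(2)]
      L2_inner_commute[of \<Omega> u "\<lambda>x. u x + t *\<^sub>R v x"] L2_inner_commute[of \<Omega> v "\<lambda>x. u x + t *\<^sub>R v x"]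
      L2_inner_commute[of \<Omega> v u]
    by (simp add: algebra_simps power2_eq_square)
qed

lemma L2_Cauchy_Schwarz:
  assumes "u \<in> L2 \<Omega>" "v \<in> L2 \<Omega>"
  shows "\<bar>L2_inner \<Omega> u v\<bar> \<le> L2_norm \<Omega> u * L2_norm \<Omega> v"
proof -
  let ?p = "L2_inner \<Omega> u u" and ?q = "L2_inner \<Omega> u v" and ?r = "L2_inner \<Omega> v v"
  have *: "0 \<le> ?p + 2 * t * ?q + t\<^sup>2 * ?r" for t
    using L2_inner_nonneg[of \<Omega> "\<lambda>x. u x + t *\<^sub>R v x"] L2_inner_add_scaled[OF assms] by simp
  have "?q\<^sup>2 \<le> ?p * ?r"
  proof (cases "?r = 0")
    case True
    have "?q = 0"
    proof (rule ccontr)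
      assume "?q \<noteq> 0"
      \<comment> \<open>This \<open>t\<close> makes the polynomial, now affine in \<open>t\<close>,
        equal to -1.\<close>
      then show False
        using *[of "- (?p + 1) / (2 * ?q)"] True by (simp add: field_simps)
    qed
    then show ?thesis
      using True by simp
  next
    case False
    then have "0 < ?r"
      using L2_inner_nonneg[of \<Omega> v] by simp
    \<comment> \<open>Here \<open>t\<close> is the minimiser of the quadratic polynomial; its
      minimum is \<open>?p - ?q\<^sup>2 / ?r\<close>.\<close>
    then show ?thesis
      using *[of "- ?q / ?r"] by (simp add: field_simps power2_eq_square)
  qed
  then have "\<bar>?q\<bar>\<^sup>2 \<le> (L2_norm \<Omega> u * L2_norm \<Omega> v)\<^sup>2"
    by (simp add: power_mult_distrib L2_norm_sq)
  then show ?thesis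
    by (rule power2_le_imp_le) (simp add: L2_norm_nonneg)
qed

lemma L2_norm_triangle:
  assumes "u \<in> L2 \<Omega>" "v \<in> L2 \<Omega>"
  shows "L2_norm \<Omega> (\<lambda>x. u x + v x) \<le> L2_norm \<Omega> u + L2_norm \<Omega> v"
proof (rule power2_le_imp_le)
  show "(L2_norm \<Omega> (\<lambda>x. u x + v x))\<^sup>2 \<le> (L2_norm \<Omega> u + L2_norm \<Omega> v)\<^sup>2"
    using L2_inner_add_scaled[OF assms, of 1] L2_Cauchy_Schwarz[OF assms]
    by (simp add: L2_norm_sq power2_sum)
qed (simp add: L2_norm_nonneg)

lemma L2_norm_triangle_diff:
  assumes "u \<in> L2 \<Omega>" "v \<in> L2 \<Omega>" "w \<in> L2 \<Omega>"
  shows "L2_norm \<Omega> (\<lambda>x. u x - w x) \<le> L2_norm \<Omega> (\<lambda>x. u x - v x) + L2_norm \<Omega> (\<lambda>x. v x - w x)"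
  using L2_norm_triangle[of "\<lambda>x. u x - v x" \<Omega> "\<lambda>x. v x - w x"] assms L2_diff by auto

lemma tendsto_L2_norm:
  assumes "\<And>n. u n \<in> L2 \<Omega>" "v \<in> L2 \<Omega>" "(\<lambda>n. L2_norm \<Omega> (\<lambda>x. u n x - v x)) \<longlonglongrightarrow> 0"
  shows "(\<lambda>n. L2_norm \<Omega> (u n)) \<longlonglongrightarrow> L2_norm \<Omega> v"
proof -
  have "\<bar>L2_norm \<Omega> (u n) - L2_norm \<Omega> v\<bar> \<le> L2_norm \<Omega> (\<lambda>x. u n x - v x)" for n
    using L2_norm_triangle_diff[OF assms(1)[of n] assms(2) L2_zero]
      L2_norm_triangle_diff[OF assms(2) assms(1)[of n] L2_zero] L2_norm_minus_commute[of \<Omega> v "u n"]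
    by simp
  then have "(\<lambda>n. L2_norm \<Omega> (u n) - L2_norm \<Omega> v) \<longlonglongrightarrow> 0"
    by (intro Lim_null_comparison[OF _ assms(3)] always_eventually) simp
  then show ?thesis
    by (simp add: LIM_zero_iff)
qed

text \<open>Cauchy-Schwarz makes the inner product continuous in its first argument. This is what
  carries identities for partial sums over to Fourier series.\<close>

lemma tendsto_L2_inner:
  assumes "\<And>n. u n \<in> L2 \<Omega>" "v \<in> L2 \<Omega>" "w \<in> L2 \<Omega>"
    "(\<lambda>n. L2_norm \<Omega> (\<lambda>x. u n x - v x)) \<longlonglongrightarrow> 0"
  shows "(\<lambda>n. L2_inner \<Omega> (u n) w) \<longlonglongrightarrow> L2_inner \<Omega> v w"
proof -
  have "\<bar>L2_inner \<Omega> (u n) w - L2_inner \<Omega> v w\<bar> \<le> L2_norm \<Omega> (\<lambda>x. u n x - v x) * L2_norm \<Omega> w" for n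
    using L2_Cauchy_Schwarz[OF L2_diff[OF assms(1)[of n] assms(2)] assms(3)] assms
    by (simp add: L2_inner_diff_left)
  then have "(\<lambda>n. L2_inner \<Omega> (u n) w - L2_inner \<Omega> v w) \<longlonglongrightarrow> 0"
    by (intro Lim_null_comparison[OF _ tendsto_mult_left_zero[OF assms(4), of "L2_norm \<Omega> w"]]
        always_eventually) simp
  then show ?thesis
    by (simp add: LIM_zero_iff)
qed

section \<open>Completeness of the space of square-integrable functions\<close>

text \<open>A rapidly Cauchy subsequence has increments that are summable in the mean, hence
  converges almost everywhere. Fatou's lemma then bounds the distance from the whole sequence to the
  pointwise limit.\<close>

lemma L2_complete:
  fixes u :: "nat \<Rightarrow> 'a::euclidean_space \<Rightarrow> real"
  assumes fin: "finite_measure (lebesgue_on \<Omega>)" and u: "\<And>n. u n \<in> L2 \<Omega>"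
    and Cauchy: "\<And>\<epsilon>. \<epsilon> > 0 \<Longrightarrow> \<exists>N. \<forall>m\<ge>N. \<forall>n\<ge>N. L2_norm \<Omega> (\<lambda>x. u m x - u n x) < \<epsilon>"
  obtains v where "v \<in> L2 \<Omega>" "(\<lambda>n. L2_norm \<Omega> (\<lambda>x. u n x - v x)) \<longlonglongrightarrow> 0"
proof -
  interpret finite_measure "lebesgue_on \<Omega>" by (rule fin)
  let ?M = "lebesgue_on \<Omega>"
  note [measurable] = L2_measurable[OF u]
  have "\<forall>k. \<exists>N. \<forall>m\<ge>N. \<forall>n\<ge>N. L2_norm \<Omega> (\<lambda>x. u m x - u n x) < (1/2) ^ k"
    using Cauchy by simp
  then obtain N where N: "\<And>k m n. m \<ge> N k \<Longrightarrow> n \<ge> N k \<Longrightarrow>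
      L2_norm \<Omega> (\<lambda>x. u m x - u n x) < (1/2) ^ k"
    by metis
  \<comment> \<open>Summing the \<open>N i\<close> spares any monotonicity of \<open>N\<close>: both
    \<open>r k\<close> and \<open>r (Suc k)\<close> lie beyond \<open>N k\<close>. The summand
    \<open>k\<close> makes \<open>r\<close> unbounded.\<close>
  define r where "r k = (\<Sum>i\<le>k. N i) + k" for k
  have rN: "N k \<le> r k" "N k \<le> r (Suc k)" "k \<le> r k" for k
    using member_le_sum[of k "{..k}" N] by (auto simp: r_def)
  define d where "d k x = u (r (Suc k)) x - u (r k) x" for k x
  have dL2: "d k \<in> L2 \<Omega>" for k
    unfolding d_def by (intro L2_diff u)
  have [measurable]: "d k \<in> borel_measurable ?M" for k
    by (rule L2_measurable[OF dL2])
  \<comment> \<open>Finiteness of the measure enters here: pairing with the constant 1 turns bounds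
    on the \<open>L2_norm\<close> of the increments into bounds on their integrals.\<close>
  have one: "(\<lambda>x. 1::real) \<in> L2 \<Omega>"
    by (simp add: L2_def)
  have abs_d: "(\<lambda>x. \<bar>d k x\<bar>) \<in> L2 \<Omega>" for k
    using dL2[of k] by (auto simp: L2_def)
  have int_d: "integrable ?M (\<lambda>x. \<bar>d k x\<bar>)" for k
    using L2_inner_integrable[OF abs_d one] by simp
  define C where "C = L2_norm \<Omega> (\<lambda>x. 1::real)"
  have d_le: "(\<integral>x. \<bar>d k x\<bar> \<partial>?M) \<le> (1/2) ^ k * C" for k
  proof -
    have "(\<integral>x. \<bar>d k x\<bar> \<partial>?M) \<le> L2_norm \<Omega> (\<lambda>x. \<bar>d k x\<bar>) * C"
      using L2_Cauchy_Schwarz[OF abs_d one] by (simp add: L2_inner_def C_def)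
    also have "L2_norm \<Omega> (\<lambda>x. \<bar>d k x\<bar>) = L2_norm \<Omega> (d k)"
      by (simp add: L2_norm_def L2_inner_def)
    also have "\<dots> * C \<le> (1/2) ^ k * C"
      using N[OF rN(2,1), of k] unfolding d_def C_def by (intro mult_right_mono L2_norm_nonneg) auto
    finally show ?thesis .
  qed
  have "(\<integral>\<^sup>+x. (\<Sum>k. ennreal \<bar>d k x\<bar>) \<partial>?M) = (\<Sum>k. \<integral>\<^sup>+x. ennreal \<bar>d k x\<bar> \<partial>?M)"
    by (intro nn_integral_suminf) measurable
  also have "\<dots> = (\<Sum>k. ennreal (\<integral>x. \<bar>d k x\<bar> \<partial>?M))"
    by (intro suminf_cong nn_integral_eq_integral int_d) auto
  also have "\<dots> \<le> (\<Sum>k. ennreal ((1/2) ^ k * C))"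
    by (intro suminf_le ennreal_leI d_le) auto
  also have "\<dots> = ennreal (\<Sum>k. (1/2) ^ k * C)"
    by (intro suminf_ennreal2) (auto intro!: summable_mult2 simp: C_def L2_norm_nonneg summable_geometric)
  finally have "(\<integral>\<^sup>+x. (\<Sum>k. ennreal \<bar>d k x\<bar>) \<partial>?M) \<noteq> \<infinity>"
    by (metis ennreal_neq_top infinity_ennreal_def top.extremum_unique)
  then have "AE x in ?M. (\<Sum>k. ennreal \<bar>d k x\<bar>) \<noteq> \<infinity>"
    by (intro nn_integral_PInf_AE) measurable
  then have conv: "AE x in ?M. convergent (\<lambda>k. u (r k) x)"
  proof eventually_elim
    case (elim x)
    have "summable (\<lambda>k. \<bar>d k x\<bar>)"
      using elim by (intro summable_suminf_not_top) auto
    then have "summable (\<lambda>k. d k x)"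
      by (rule summable_rabs_cancel)
    then have "convergent (\<lambda>n. \<Sum>k<n. d k x)"
      by (simp add: summable_iff_convergent)
    then have "convergent (\<lambda>n. u (r n) x - u (r 0) x)"
      unfolding d_def sum_lessThan_telescope[of "\<lambda>k. u (r k) x"] .
    then show ?case
      using convergent_add[OF _ convergent_const[of "u (r 0) x"], of "\<lambda>n. u (r n) x - u (r 0) x"]
      by simp
  qed
  \<comment> \<open>Where the subsequence diverges \<open>lim\<close> is an unspecified value, but
    by \<open>conv\<close> this happens only on a null set.\<close>
  define v where "v x = lim (\<lambda>k. u (r k) x)" for x
  have v_meas[measurable]: "v \<in> borel_measurable ?M"
    unfolding v_def by (rule borel_measurable_lim_metric) measurable
  have v_lim: "AE x in ?M. (\<lambda>k. u (r k) x) \<longlonglongrightarrow> v x"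
    using conv by eventually_elim (simp add: v_def convergent_LIMSEQ_iff)
  \<comment> \<open>The index \<open>m\<close> stays fixed while \<open>r k\<close> tends to
    infinity, so the estimate holds for every \<open>m\<close> beyond \<open>N j\<close> and not
    only along the subsequence.\<close>
  have Fatou: "(\<integral>\<^sup>+x. ennreal ((u m x - v x)\<^sup>2) \<partial>?M) \<le> ennreal (((1/2) ^ j)\<^sup>2)"
    if "m \<ge> N j" for m j
  proof -
    have "(\<integral>\<^sup>+x. ennreal ((u m x - v x)\<^sup>2) \<partial>?M)
        = (\<integral>\<^sup>+x. liminf (\<lambda>k. ennreal ((u m x - u (r k) x)\<^sup>2)) \<partial>?M)"
    proof (rule nn_integral_cong_AE)
      show "AE x in ?M. ennreal ((u m x - v x)\<^sup>2) = liminf (\<lambda>k. ennreal ((u m x - u (r k) x)\<^sup>2))"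
        using v_lim
      proof eventually_elim
        case (elim x)
        then have "(\<lambda>k. ennreal ((u m x - u (r k) x)\<^sup>2)) \<longlonglongrightarrow> ennreal ((u m x - v x)\<^sup>2)"
          by (intro tendsto_intros)
        then show ?case
          using lim_imp_Liminf[OF sequentially_bot] by metis
      qed
    qed
    also have "\<dots> \<le> liminf (\<lambda>k. \<integral>\<^sup>+x. ennreal ((u m x - u (r k) x)\<^sup>2) \<partial>?M)"
      by (intro nn_integral_liminf) measurable
    also have "\<dots> \<le> ennreal (((1/2) ^ j)\<^sup>2)"
    proof (rule Liminf_le)
      show "\<forall>\<^sub>F k in sequentially. (\<integral>\<^sup>+x. ennreal ((u m x - u (r k) x)\<^sup>2) \<partial>?M) \<le> ennreal (((1/2) ^ j)\<^sup>2)"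
        using eventually_ge_at_top[of "N j"]
      proof eventually_elim
        case (elim k)
        have "(\<integral>\<^sup>+x. ennreal ((u m x - u (r k) x)\<^sup>2) \<partial>?M) = ennreal ((L2_norm \<Omega> (\<lambda>x. u m x - u (r k) x))\<^sup>2)"
          using nn_integral_norm_sq_eq_L2_norm[OF L2_diff[OF u[of m] u[of "r k"]]] by simp
        also have "\<dots> \<le> ennreal (((1/2) ^ j)\<^sup>2)"
          using N[of j m "r k"] that elim rN(3)[of k] L2_norm_nonneg
          by (intro ennreal_leI power_mono) (auto intro: less_imp_le order_trans)
        finally show ?case .
      qed
    qed simp
    finally show ?thesis .
  qed
  have diff_L2: "(\<lambda>x. u m x - v x) \<in> L2 \<Omega>" if "m \<ge> N j" for m j
    using le_less_trans[OF Fatou[OF that] ennreal_less_top]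
    by (simp add: L2_def integrable_iff_bounded)
  have "v \<in> L2 \<Omega>"
    using L2_diff[OF u[of "N 0"] diff_L2[of 0 "N 0"]] by simp
  moreover have "(\<lambda>n. L2_norm \<Omega> (\<lambda>x. u n x - v x)) \<longlonglongrightarrow> 0"
  proof (rule LIMSEQ_I)
    fix \<epsilon> :: real assume "\<epsilon> > 0"
    then obtain j where j: "(1/2) ^ j < \<epsilon>"
      using real_arch_pow_inv[OF \<open>\<epsilon> > 0\<close>, of "1/2"] half_gt_zero_iff by force
    show "\<exists>n0. \<forall>n\<ge>n0. norm (L2_norm \<Omega> (\<lambda>x. u n x - v x) - 0) < \<epsilon>"
    proof (intro exI allI impI)
      fix n assume n: "n \<ge> N j"
      have "ennreal ((L2_norm \<Omega> (\<lambda>x. u n x - v x))\<^sup>2) = (\<integral>\<^sup>+x. ennreal ((u n x - v x)\<^sup>2) \<partial>?M)"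
        using nn_integral_norm_sq_eq_L2_norm[OF diff_L2[OF n]] by simp
      then have "(L2_norm \<Omega> (\<lambda>x. u n x - v x))\<^sup>2 \<le> ((1/2) ^ j)\<^sup>2"
        using Fatou[OF n] by (metis ennreal_le_iff zero_le_power2)
      then have "L2_norm \<Omega> (\<lambda>x. u n x - v x) \<le> (1/2) ^ j"
        by (rule power2_le_imp_le) simp
      then show "norm (L2_norm \<Omega> (\<lambda>x. u n x - v x) - 0) < \<epsilon>"
        using j L2_norm_nonneg[of \<Omega> "\<lambda>x. u n x - v x"] by simp
    qed
  qed
  ultimately show ?thesis ..
qed

section \<open>Fourier expansions in an orthonormal basis\<close>

text \<open>Pair the partial sums of the expansion of \<open>u\<close> with \<open>v\<close> and
  pass to the limit by continuity of the inner product.\<close>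

lemma orthonormal_basis_L2_Parseval:
  assumes e: "orthonormal_basis_L2 \<Omega> e" and u: "u \<in> L2 \<Omega>" and v: "v \<in> L2 \<Omega>"
  shows "(\<lambda>k. L2_inner \<Omega> u (e k) * L2_inner \<Omega> v (e k)) sums L2_inner \<Omega> u v"
proof -
  have eL2: "e k \<in> L2 \<Omega>" for k
    using e by (simp add: orthonormal_basis_L2_def)
  define p where "p n x = (\<Sum>k<n. L2_inner \<Omega> u (e k) * e k x)" for n x
  have pL2: "p n \<in> L2 \<Omega>" for n
    unfolding p_def using L2_scaleR[OF eL2] by (intro L2_sum) auto
  have "L2_sums \<Omega> (\<lambda>k x. L2_inner \<Omega> u (e k) * e k x) u"
    using e u by (simp add: orthonormal_basis_L2_def)
  then have "(\<lambda>n. L2_norm \<Omega> (\<lambda>x. p n x - u x)) \<longlonglongrightarrow> 0"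
    by (simp add: L2_sums_def p_def)
  then have "(\<lambda>n. L2_inner \<Omega> (p n) v) \<longlonglongrightarrow> L2_inner \<Omega> u v"
    by (intro tendsto_L2_inner pL2 u v)
  moreover have "L2_inner \<Omega> (p n) v = (\<Sum>k<n. L2_inner \<Omega> u (e k) * L2_inner \<Omega> v (e k))" for n
    unfolding p_def using L2_scaleR[OF eL2] L2_inner_scaleR_left[of \<Omega> _ "e _" v]
    by (subst L2_inner_sum_left) (auto simp: v L2_inner_commute[of \<Omega> v])
  ultimately show ?thesis
    by (simp add: sums_def)
qed

lemma orthonormal_L2_norm_sq_sum:
  assumes e: "orthonormal_basis_L2 \<Omega> e" and "finite I"
  shows "(L2_norm \<Omega> (\<lambda>x. \<Sum>k\<in>I. c k * e k x))\<^sup>2 = (\<Sum>k\<in>I. (c k)\<^sup>2)"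
proof -
  have eL2: "(\<lambda>x. c k * e k x) \<in> L2 \<Omega>" for k
    using e L2_scaleR[of "e k" \<Omega> "c k"] by (simp add: orthonormal_basis_L2_def)
  have orth: "L2_inner \<Omega> (\<lambda>x. c j * e j x) (\<lambda>x. c k * e k x) = (if j = k then (c k)\<^sup>2 else 0)" for j k
    using e L2_inner_scaleR_left[of \<Omega> "c j" "e j" "\<lambda>x. c k * e k x"]
      L2_inner_scaleR_left[of \<Omega> "c k" "e k" "e j"]
    by (simp add: orthonormal_basis_L2_def L2_inner_commute[of \<Omega> "e j" "\<lambda>x. c k * e k x"] power2_eq_square)
  have "(L2_norm \<Omega> (\<lambda>x. \<Sum>k\<in>I. c k * e k x))\<^sup>2
      = (\<Sum>j\<in>I. L2_inner \<Omega> (\<lambda>x. c j * e j x) (\<lambda>x. \<Sum>k\<in>I. c k * e k x))"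
    unfolding L2_norm_sq by (rule L2_inner_sum_left) (auto intro: L2_sum eL2)
  also have "\<dots> = (\<Sum>j\<in>I. \<Sum>k\<in>I. L2_inner \<Omega> (\<lambda>x. c k * e k x) (\<lambda>x. c j * e j x))"
    by (subst L2_inner_commute, subst L2_inner_sum_left) (auto intro: eL2)
  also have "\<dots> = (\<Sum>k\<in>I. (c k)\<^sup>2)"
    using \<open>finite I\<close> by (simp add: orth)
  finally show ?thesis .
qed

text \<open>By Pythagoras, distances between partial sums are tails of the numerical series, so
  completeness supplies a limit. This guarantees that the choice in \<open>control_to_state\<close>
  picks an actual sum.\<close>

lemma orthonormal_basis_L2_Riesz_Fischer:
  assumes e: "orthonormal_basis_L2 \<Omega> e" and fin: "finite_measure (lebesgue_on \<Omega>)"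
    and c: "summable (\<lambda>k. (c k)\<^sup>2)"
  obtains u where "L2_sums \<Omega> (\<lambda>k x. c k * e k x) u"
proof -
  define p where "p n x = (\<Sum>k<n. c k * e k x)" for n x
  have eL2: "(\<lambda>x. c k * e k x) \<in> L2 \<Omega>" for k
    using e L2_scaleR[of "e k" \<Omega> "c k"] by (simp add: orthonormal_basis_L2_def)
  have pL2: "p n \<in> L2 \<Omega>" for n
    unfolding p_def by (intro L2_sum eL2)
  have diff: "(L2_norm \<Omega> (\<lambda>x. p n x - p m x))\<^sup>2 = (\<Sum>k=m..<n. (c k)\<^sup>2)" if "m \<le> n" for m n
  proof -
    have "p n x - p m x = (\<Sum>k=m..<n. c k * e k x)" for x
      using sum_diff_nat_ivl[of 0 m n "\<lambda>k. c k * e k x"] that by (simp add: p_def atLeast0LessThan)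
    then show ?thesis
      by (simp add: orthonormal_L2_norm_sq_sum[OF e])
  qed
  have Cauchy: "\<exists>N. \<forall>m\<ge>N. \<forall>n\<ge>N. L2_norm \<Omega> (\<lambda>x. p m x - p n x) < \<epsilon>" if "\<epsilon> > 0" for \<epsilon>
  proof -
    obtain N where N: "\<And>m n. m \<ge> N \<Longrightarrow> norm (\<Sum>k=m..<n. (c k)\<^sup>2) < \<epsilon>\<^sup>2"
      using c \<open>\<epsilon> > 0\<close> unfolding summable_Cauchy by (meson zero_less_power)
    have *: "L2_norm \<Omega> (\<lambda>x. p n x - p m x) < \<epsilon>" if "N \<le> m" "m \<le> n" for m n
    proof (rule power2_less_imp_less)
      show "(L2_norm \<Omega> (\<lambda>x. p n x - p m x))\<^sup>2 < \<epsilon>\<^sup>2"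
        using N[OF that(1), of n] diff[OF that(2)] by (simp add: sum_nonneg)
    qed (use \<open>\<epsilon> > 0\<close> in simp)
    show ?thesis
    proof (intro exI allI impI)
      fix m n assume "N \<le> m" "N \<le> n"
      then show "L2_norm \<Omega> (\<lambda>x. p m x - p n x) < \<epsilon>"
        using *[of m n] *[of n m] L2_norm_minus_commute[of \<Omega> "p m" "p n"]
        by (cases "m \<le> n") auto
    qed
  qed
  obtain u where "u \<in> L2 \<Omega>" "(\<lambda>n. L2_norm \<Omega> (\<lambda>x. p n x - u x)) \<longlonglongrightarrow> 0"
    using L2_complete[OF fin pL2 Cauchy] by blast
  then show ?thesis
    by (intro that[of u]) (simp add: L2_sums_def p_def)
qed

text \<open>Paired with \<open>e j\<close>, the partial sums become those of a series with a single
  nonzero term. The coefficients of the state can thus be read off whichever representative is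
  chosen.\<close>

lemma L2_sums_coefficient:
  assumes e: "orthonormal_basis_L2 \<Omega> e" and u: "L2_sums \<Omega> (\<lambda>k x. c k * e k x) u"
  shows "L2_inner \<Omega> u (e j) = c j"
proof -
  have eL2: "e k \<in> L2 \<Omega>" for k
    using e by (simp add: orthonormal_basis_L2_def)
  have ceL2: "(\<lambda>x. c k * e k x) \<in> L2 \<Omega>" for k
    using L2_scaleR[OF eL2, of "c k" k] by simp
  have "L2_inner \<Omega> (\<lambda>x. \<Sum>k<n. c k * e k x) (e j) = (\<Sum>k<n. if k = j then c k else 0)" for n
  proof -
    have "L2_inner \<Omega> (\<lambda>x. c k * e k x) (e j) = (if k = j then c k else 0)" for k
      using e L2_inner_scaleR_left[of \<Omega> "c k" "e k" "e j"] by (simp add: orthonormal_basis_L2_def)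
    then show ?thesis
      by (simp add: L2_inner_sum_left ceL2 eL2)
  qed
  moreover have "(\<lambda>n. L2_inner \<Omega> (\<lambda>x. \<Sum>k<n. c k * e k x) (e j)) \<longlonglongrightarrow> L2_inner \<Omega> u (e j)"
    using u by (intro tendsto_L2_inner L2_sum ceL2 eL2) (auto simp: L2_sums_def)
  ultimately have "(\<lambda>k. if k = j then c k else 0) sums L2_inner \<Omega> u (e j)"
    by (simp add: sums_def)
  moreover have "(\<lambda>k. if k = j then c k else 0) sums c j"
    by (rule sums_single)
  ultimately show ?thesis
    by (rule sums_unique2)
qed

subsection \<open>The Poincare inequality\<close>

lemma L2_norm_le_of_norm_le:
  assumes "u \<in> L2 \<Omega>" "v \<in> L2 \<Omega>" "0 \<le> c" "\<And>x. x \<in> \<Omega> \<Longrightarrow> norm (u x) \<le> c * norm (v x)"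
  shows "L2_norm \<Omega> u \<le> c * L2_norm \<Omega> v"
proof (rule power2_le_imp_le)
  have "(\<integral>x. (norm (u x))\<^sup>2 \<partial>lebesgue_on \<Omega>) \<le> (\<integral>x. c\<^sup>2 * (norm (v x))\<^sup>2 \<partial>lebesgue_on \<Omega>)"
  proof (rule integral_mono_AE)
    show "AE x in lebesgue_on \<Omega>. (norm (u x))\<^sup>2 \<le> c\<^sup>2 * (norm (v x))\<^sup>2"
      using power_mono[OF assms(4) norm_ge_zero, of _ 2] by (intro AE_I2) (simp add: power_mult_distrib)
  qed (use assms L2_integrable_norm_sq in auto)
  then show "(L2_norm \<Omega> u)\<^sup>2 \<le> (c * L2_norm \<Omega> v)\<^sup>2"
    by (simp add: power_mult_distrib L2_norm_sq L2_inner_def power2_norm_eq_inner)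
qed (simp add: assms L2_norm_nonneg)

section \<open>Functions of compact support\<close>

lemma has_derivative_zero_outside_closed:
  assumes "closed K" "\<And>x. x \<notin> K \<Longrightarrow> g x = 0" "(g has_derivative g') (at x)" "x \<notin> K"
  shows "g' = (\<lambda>_. 0)"
proof -
  have "((\<lambda>_. 0) has_derivative g') (at x)"
    using assms by (intro has_derivative_transform_within_open[OF assms(3), of "- K"]) auto
  then show ?thesis
    by (rule has_derivative_unique) simp
qed

lemma integrable_continuous_compact_support:
  fixes h :: "'a::euclidean_space \<Rightarrow> 'b::euclidean_space"
  assumes "compact K" "continuous_on UNIV h" "\<And>x. x \<notin> K \<Longrightarrow> h x = 0"
  shows "integrable lborel h"
proof -
  have "integrable lborel (\<lambda>x. indicator K x *\<^sub>R h x)"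
    using assms by (intro borel_integrable_compact) (auto intro: continuous_on_subset)
  moreover have "(\<lambda>x. indicator K x *\<^sub>R h x) = h"
    using assms(3) by (force simp: indicator_def)
  ultimately show ?thesis by simp
qed

text \<open>Since \<open>K\<close> lies inside \<open>\<Omega>\<close>, multiplying by the indicator
  of \<open>\<Omega>\<close> does not change \<open>h\<close>. Integrals over the domain thereby
  become integrals over the whole space, where translation invariance is available.\<close>

lemma
  fixes h :: "'a::euclidean_space \<Rightarrow> 'b::euclidean_space"
  assumes "\<Omega> \<in> sets lebesgue" "compact K" "K \<subseteq> \<Omega>" "continuous_on UNIV h" "\<And>x. x \<notin> K \<Longrightarrow> h x = 0"
  shows integrable_lebesgue_on_compact_support: "integrable (lebesgue_on \<Omega>) h"
    and integral_lebesgue_on_compact_support: "(LINT x|lebesgue_on \<Omega>. h x) = (LINT x|lborel. h x)"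
proof -
  have "(\<lambda>x. indicator \<Omega> x *\<^sub>R h x) = h"
    using assms(3,5) by (force simp: indicator_def)
  moreover have "h \<in> borel_measurable lborel"
    using assms(4) borel_measurable_continuous_onI by auto
  moreover have "integrable lborel h"
    using assms by (intro integrable_continuous_compact_support[of K])
  ultimately show "integrable (lebesgue_on \<Omega>) h" "(LINT x|lebesgue_on \<Omega>. h x) = (LINT x|lborel. h x)"
    using assms(1) by (simp_all add: integrable_restrict_space integral_restrict_space
        integrable_completion integral_completion)
qed

lemma L2_continuous_compact_support:
  fixes h :: "'a::euclidean_space \<Rightarrow> 'b::euclidean_space"
  assumes "\<Omega> \<in> sets lebesgue" "compact K" "K \<subseteq> \<Omega>" "continuous_on UNIV h" "\<And>x. x \<notin> K \<Longrightarrow> h x = 0"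
  shows "h \<in> L2 \<Omega>"
proof -
  have "integrable (lebesgue_on \<Omega>) (\<lambda>x. (norm (h x))\<^sup>2)"
    using assms by (intro integrable_lebesgue_on_compact_support[of _ K] continuous_intros) auto
  moreover have "h \<in> borel_measurable (lebesgue_on \<Omega>)"
    using integrable_lebesgue_on_compact_support[OF assms] by (rule borel_measurable_integrable)
  ultimately show ?thesis
    by (simp add: L2_def)
qed

text \<open>By translation invariance the difference quotients of \<open>g\<close> in direction \<open>b\<close> have integral zero;
  this passes to the limit by dominated convergence.\<close>

lemma integral_directional_derivative_compact_support:
  fixes g :: "'a::euclidean_space \<Rightarrow> real"
  assumes K: "compact K" and g0: "\<And>x. x \<notin> K \<Longrightarrow> g x = 0"
    and deriv: "\<And>x. (g has_derivative g' x) (at x)"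
    and cont: "continuous_on UNIV (\<lambda>x. g' x b)"
  shows "(LINT x|lborel. g' x b) = 0"
proof -
  have g'0: "g' x b = 0" if "x \<notin> K" for x
    using has_derivative_zero_outside_closed[OF compact_imp_closed[OF K] g0 deriv that] by simp
  have g_cont: "continuous_on UNIV g"
    using has_derivative_continuous[OF deriv] by (simp add: continuous_on_eq_continuous_at)
  have [measurable]: "g \<in> borel_measurable borel" "(\<lambda>x. g' x b) \<in> borel_measurable borel"
    using g_cont cont by (auto intro: borel_measurable_continuous_onI)
  obtain C where C: "\<And>x. x \<in> K \<Longrightarrow> norm (g' x b) \<le> C"
    using compact_imp_bounded[OF compact_continuous_image[OF continuous_on_subset[OF cont subset_UNIV] K]]
    by (auto simp: bounded_iff)
  define B where "B = max C 0"
  have B: "norm (g' x b) \<le> B" for x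
    using C[of x] g'0[of x] by (cases "x \<in> K") (auto simp: B_def)
  obtain R where R: "\<And>x. x \<in> K \<Longrightarrow> norm x \<le> R"
    using compact_imp_bounded[OF K] by (auto simp: bounded_iff)
  define h where "h n = inverse (real (Suc n))" for n
  have h: "0 < h n" "h n \<le> 1" for n
    by (auto simp: h_def divide_simps)
  have h_lim: "h \<longlonglongrightarrow> 0"
    unfolding h_def by (rule LIMSEQ_inverse_real_of_nat)
  define d where "d n x = (g (x + h n *\<^sub>R b) - g x) / h n" for n x
  have line: "((\<lambda>t. g (x + t *\<^sub>R b)) has_real_derivative g' (x + t *\<^sub>R b) b) (at t)" for x t
  proof -
    have "((\<lambda>t. g (x + t *\<^sub>R b)) has_derivative (\<lambda>s. g' (x + t *\<^sub>R b) (s *\<^sub>R b))) (at t)"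
      by (rule has_derivative_compose[OF _ deriv]) (auto intro!: derivative_eq_intros)
    moreover have "g' (x + t *\<^sub>R b) (s *\<^sub>R b) = g' (x + t *\<^sub>R b) b * s" for s
      using linear_cmul[OF has_derivative_linear[OF deriv]] by simp
    ultimately show ?thesis
      by (simp add: has_field_derivative_def)
  qed
  \<comment> \<open>Inside the ball the mean value theorem bounds the quotient by \<open>B\<close>.
    Outside it, both \<open>x\<close> and the shifted point miss \<open>K\<close>, because the shift
    has length at most \<open>norm b\<close>, and the quotient vanishes.\<close>
  have d_le: "norm (d n x) \<le> B * indicator (cball 0 (R + norm b)) x" for n x
  proof (cases "x \<in> cball 0 (R + norm b)")
    case True
    obtain z where "g (x + h n *\<^sub>R b) - g (x + 0 *\<^sub>R b) = (h n - 0) * g' (x + z *\<^sub>R b) b"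
      using MVT2[OF h(1)[of n], of "\<lambda>t. g (x + t *\<^sub>R b)" "\<lambda>t. g' (x + t *\<^sub>R b) b"] line by blast
    then have "d n x = g' (x + z *\<^sub>R b) b"
      using h(1)[of n] by (simp add: d_def)
    then show ?thesis
      using B True by simp
  next
    case False
    have "norm (h n *\<^sub>R b) \<le> norm b"
      using h[of n] by (simp add: mult_left_le_one_le)
    then have "x \<notin> K" "x + h n *\<^sub>R b \<notin> K"
      using False R[of x] R[of "x + h n *\<^sub>R b"] norm_triangle_ineq4[of "x + h n *\<^sub>R b" "h n *\<^sub>R b"] norm_ge_zero[of b]
      by (auto simp: mem_cball_0)
    then show ?thesis
      using False by (simp add: d_def g0)
  qed
  have lim: "(\<lambda>n. d n x) \<longlonglongrightarrow> g' x b" for x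
  proof -
    have "((\<lambda>t. (g (x + t *\<^sub>R b) - g x) / t) \<longlongrightarrow> g' x b) (at 0)"
      using line[of x 0] by (simp add: DERIV_def)
    moreover have "filterlim h (at 0) sequentially"
      using h_lim h(1) by (auto simp: filterlim_at less_le intro!: always_eventually)
    ultimately show ?thesis
      unfolding d_def by (rule filterlim_compose)
  qed
  have "(\<lambda>n. LINT x|lborel. d n x) \<longlonglongrightarrow> (LINT x|lborel. g' x b)"
  proof (rule integral_dominated_convergence)
    show "integrable lborel (\<lambda>x. B * indicator (cball 0 (R + norm b)) x)"
      by (intro integrable_mult_right integrable_real_indicator)
        (use emeasure_lborel_cball_finite in \<open>auto simp: less_top\<close>)
  qed (use d_le lim in \<open>auto simp: d_def[abs_def]\<close>)
  moreover have "(LINT x|lborel. d n x) = 0" for n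
  proof -
    have int: "integrable lborel g"
      by (rule integrable_continuous_compact_support[OF K g_cont g0])
    \<comment> \<open>Translation invariance of Lebesgue measure: the two integrals in the
      difference quotient cancel.\<close>
    have shift: "integrable lborel (\<lambda>x. g (h n *\<^sub>R b + x))"
      "(LINT x|lborel. g (h n *\<^sub>R b + x)) = (LINT x|lborel. g x)"
      using int integrable_distr_eq[of "(+) (h n *\<^sub>R b)" lborel borel g]
        integral_distr[of "(+) (h n *\<^sub>R b)" lborel borel g] lborel_distr_plus[of "h n *\<^sub>R b"]
      by simp_all
    then show ?thesis
      using int by (simp add: d_def add.commute)
  qed
  ultimately show ?thesis
    by (simp add: LIMSEQ_const_iff)
qed

lemma
  assumes "\<psi> \<in> test_functions \<Omega>"
  shows test_functions_has_derivative: "(\<psi> has_derivative frechet_derivative \<psi> (at x)) (at x)"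
    and test_functions_continuous: "continuous_on UNIV \<psi>"
    and test_functions_continuous_derivative:
      "b \<in> Basis \<Longrightarrow> continuous_on UNIV (\<lambda>x. frechet_derivative \<psi> (at x) b)"
proof -
  have "\<forall>m. continuously_differentiable m \<psi>"
    using assms by (simp add: test_functions_def)
  then have "continuously_differentiable (Suc 0) \<psi>" "continuously_differentiable 0 \<psi>"
    by blast+
  then show "(\<psi> has_derivative frechet_derivative \<psi> (at x)) (at x)" "continuous_on UNIV \<psi>"
      "b \<in> Basis \<Longrightarrow> continuous_on UNIV (\<lambda>x. frechet_derivative \<psi> (at x) b)"
    by (auto simp: frechet_derivative_works)
qed

lemma grad_inner_Basis: "b \<in> Basis \<Longrightarrow> grad \<psi> x \<bullet> b = frechet_derivative \<psi> (at x) b"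
  by (simp add: grad_def inner_sum_left_Basis)

lemma
  assumes "\<psi> \<in> test_functions \<Omega>" "\<Omega> \<in> sets lebesgue"
  shows test_functions_L2: "\<psi> \<in> L2 \<Omega>" and test_functions_grad_L2: "grad \<psi> \<in> L2 \<Omega>"
proof -
  define K where "K = closure {x. \<psi> x \<noteq> 0}"
  have K: "compact K" "K \<subseteq> \<Omega>"
    using assms by (auto simp: test_functions_def K_def)
  have \<psi>0: "\<psi> x = 0" if "x \<notin> K" for x
    using that closure_subset[of "{x. \<psi> x \<noteq> 0}"] by (auto simp: K_def)
  have D0: "frechet_derivative \<psi> (at x) = (\<lambda>_. 0)" if "x \<notin> K" for x
    by (rule has_derivative_zero_outside_closed[OF compact_imp_closed[OF K(1)] \<psi>0
          test_functions_has_derivative[OF assms(1)] that])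
  show "\<psi> \<in> L2 \<Omega>"
    using assms test_functions_continuous by (intro L2_continuous_compact_support[OF _ K] \<psi>0)
  show "grad \<psi> \<in> L2 \<Omega>"
  proof (rule L2_continuous_compact_support[OF assms(2) K])
    show "continuous_on UNIV (grad \<psi>)"
      unfolding grad_def[abs_def]
      by (intro continuous_intros test_functions_continuous_derivative[OF assms(1)])
  qed (simp add: grad_def D0)
qed

text \<open>Integrate the derivative of \<open>(x \<bullet> b) \<psi>(x)\<^sup>2\<close> in the direction of a basis vector \<open>b\<close>.\<close>

lemma Poincare_inequality_test_functions:
  assumes \<psi>: "\<psi> \<in> test_functions \<Omega>" and \<Omega>: "\<Omega> \<in> sets lebesgue"
    and R: "\<And>x. x \<in> \<Omega> \<Longrightarrow> norm x \<le> R" and "0 \<le> R"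
  shows "L2_norm \<Omega> \<psi> \<le> 2 * R * L2_norm \<Omega> (grad \<psi>)"
proof -
  define K where "K = closure {x. \<psi> x \<noteq> 0}"
  have K: "compact K" "K \<subseteq> \<Omega>"
    using \<psi> by (auto simp: test_functions_def K_def)
  have \<psi>0: "\<psi> x = 0" if "x \<notin> K" for x
    using that closure_subset[of "{x. \<psi> x \<noteq> 0}"] by (auto simp: K_def)
  obtain b :: 'a where b: "b \<in> Basis"
    using nonempty_Basis by blast
  note [continuous_intros] = test_functions_continuous[OF \<psi>] test_functions_continuous_derivative[OF \<psi> b]
  let ?D = "\<lambda>x. frechet_derivative \<psi> (at x)"
  \<comment> \<open>Chosen so that \<open>q x \<bullet> grad \<psi> x\<close> is the mixed term of
    the product rule, while \<open>norm (q x)\<close> is at most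
    \<open>R * \<bar>\<psi> x\<bar>\<close> on the domain.\<close>
  define q where "q x = ((x \<bullet> b) * \<psi> x) *\<^sub>R b" for x
  have qL2: "q \<in> L2 \<Omega>"
    unfolding q_def[abs_def]
    by (rule L2_continuous_compact_support[OF \<Omega> K]) (auto intro!: continuous_intros simp: \<psi>0)
  note gL2 = test_functions_grad_L2[OF \<psi> \<Omega>] and \<psi>L2 = test_functions_L2[OF \<psi> \<Omega>]
  have "(LINT x|lborel. (b \<bullet> b) * (\<psi> x)\<^sup>2 + (x \<bullet> b) * (2 * \<psi> x * ?D x b)) = 0"
  proof (rule integral_directional_derivative_compact_support[OF K(1),
        where g = "\<lambda>x. (x \<bullet> b) * (\<psi> x)\<^sup>2" and b = b
          and g' = "\<lambda>x v. (v \<bullet> b) * (\<psi> x)\<^sup>2 + (x \<bullet> b) * (2 * \<psi> x * ?D x v)"])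
    show "((\<lambda>x. (x \<bullet> b) * (\<psi> x)\<^sup>2) has_derivative
        (\<lambda>v. (v \<bullet> b) * (\<psi> x)\<^sup>2 + (x \<bullet> b) * (2 * \<psi> x * ?D x v))) (at x)" for x
      by (auto intro!: derivative_eq_intros test_functions_has_derivative[OF \<psi>] simp: fun_eq_iff)
  qed (auto simp: \<psi>0 intro!: continuous_intros)
  then have "0 = (LINT x|lebesgue_on \<Omega>. (b \<bullet> b) * (\<psi> x)\<^sup>2 + (x \<bullet> b) * (2 * \<psi> x * ?D x b))"
    by (subst integral_lebesgue_on_compact_support[OF \<Omega> K]) (auto simp: \<psi>0 intro!: continuous_intros)
  also have "\<dots> = (LINT x|lebesgue_on \<Omega>. \<psi> x \<bullet> \<psi> x + 2 * (q x \<bullet> grad \<psi> x))"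
    using b by (intro Bochner_Integration.integral_cong)
      (auto simp: q_def inner_Basis grad_inner_Basis inner_commute[of b "grad \<psi> _"] power2_eq_square)
  also have "\<dots> = L2_inner \<Omega> \<psi> \<psi> + 2 * L2_inner \<Omega> q (grad \<psi>)"
    unfolding L2_inner_def using L2_inner_integrable[OF \<psi>L2 \<psi>L2] L2_inner_integrable[OF qL2 gL2]
    by (subst Bochner_Integration.integral_add) auto
  finally have "(L2_norm \<Omega> \<psi>)\<^sup>2 \<le> 2 * \<bar>L2_inner \<Omega> q (grad \<psi>)\<bar>"
    by (simp add: L2_norm_sq)
  also have "\<bar>L2_inner \<Omega> q (grad \<psi>)\<bar> \<le> L2_norm \<Omega> q * L2_norm \<Omega> (grad \<psi>)"
    by (rule L2_Cauchy_Schwarz[OF qL2 gL2])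
  also have "L2_norm \<Omega> q \<le> R * L2_norm \<Omega> \<psi>"
  proof (rule L2_norm_le_of_norm_le[OF qL2 \<psi>L2 \<open>0 \<le> R\<close>])
    fix x assume "x \<in> \<Omega>"
    have "\<bar>x \<bullet> b\<bar> \<le> R"
      using Basis_le_norm[OF b, of x] R[OF \<open>x \<in> \<Omega>\<close>] by simp
    then show "norm (q x) \<le> R * norm (\<psi> x)"
      using b by (simp add: q_def abs_mult mult_right_mono)
  qed
  finally have *: "(L2_norm \<Omega> \<psi>)\<^sup>2 \<le> 2 * (R * L2_norm \<Omega> \<psi> * L2_norm \<Omega> (grad \<psi>))"
    by (simp add: L2_norm_nonneg mult_right_mono)
  show ?thesis
  proof (cases "L2_norm \<Omega> \<psi> = 0")
    case True
    then show ?thesis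
      using \<open>0 \<le> R\<close> by (simp add: L2_norm_nonneg)
  next
    case False
    then have "0 < L2_norm \<Omega> \<psi>"
      using L2_norm_nonneg[of \<Omega> \<psi>] by simp
    moreover have "L2_norm \<Omega> \<psi> * L2_norm \<Omega> \<psi> \<le> L2_norm \<Omega> \<psi> * (2 * R * L2_norm \<Omega> (grad \<psi>))"
      using * by (simp add: power2_eq_square algebra_simps)
    ultimately show ?thesis
      by (simp add: mult_le_cancel_left)
  qed
qed

lemma weak_grad_L2:
  assumes "u \<in> H1 \<Omega>"
  shows "weak_grad \<Omega> u \<in> L2 \<Omega>"
proof -
  have "is_weak_grad \<Omega> u (weak_grad \<Omega> u)"
    using assms someI_ex[of "is_weak_grad \<Omega> u"] unfolding H1_def weak_grad_def by auto
  then show ?thesis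
    by (simp add: is_weak_grad_def)
qed

text \<open>Both sides are continuous along the approximating test functions, so the inequality
  survives the limit.\<close>

lemma Poincare_inequality_H10:
  assumes u: "u \<in> H10 \<Omega>" and \<Omega>: "\<Omega> \<in> sets lebesgue"
    and R: "\<And>x. x \<in> \<Omega> \<Longrightarrow> norm x \<le> R" and "0 \<le> R"
  shows "L2_norm \<Omega> u \<le> 2 * R * L2_norm \<Omega> (weak_grad \<Omega> u)"
proof -
  obtain \<psi> where \<psi>: "\<And>m::nat. \<psi> m \<in> test_functions \<Omega>"
    and lim: "(\<lambda>m. L2_norm \<Omega> (\<lambda>x. \<psi> m x - u x)) \<longlonglongrightarrow> 0"
      "(\<lambda>m. L2_norm \<Omega> (\<lambda>x. grad (\<psi> m) x - weak_grad \<Omega> u x)) \<longlonglongrightarrow> 0"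
    using u by (auto simp: H10_def)
  have "u \<in> H1 \<Omega>" "u \<in> L2 \<Omega>"
    using u by (auto simp: H10_def H1_def)
  then have "(\<lambda>m. L2_norm \<Omega> (\<psi> m)) \<longlonglongrightarrow> L2_norm \<Omega> u"
    "(\<lambda>m. L2_norm \<Omega> (grad (\<psi> m))) \<longlonglongrightarrow> L2_norm \<Omega> (weak_grad \<Omega> u)"
    using test_functions_L2[OF \<psi> \<Omega>] test_functions_grad_L2[OF \<psi> \<Omega>] weak_grad_L2 lim
    by (auto intro!: tendsto_L2_norm)
  then show ?thesis
    by (intro LIMSEQ_le[OF _ tendsto_mult_left])
      (use Poincare_inequality_test_functions[OF \<psi> \<Omega> R \<open>0 \<le> R\<close>] in auto)
qed

text \<open>Testing the eigenvalue equation with \<open>e k\<close> itself shows that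
  \<open>\<mu> k\<close> is the squared norm of the weak gradient of a unit vector; Poincare bounds
  it below. The bound \<open>m\<close> is fixed before \<open>\<mu>\<close> and \<open>e\<close>, so
  that it depends on \<open>\<Omega>\<close> alone.\<close>

lemma dirichlet_eigenbasis_bounded_below:
  assumes "bounded \<Omega>" "\<Omega> \<in> sets lebesgue"
  obtains m where "0 < m" "\<And>\<mu> e k. dirichlet_eigenbasis \<Omega> \<mu> e \<Longrightarrow> m \<le> \<mu> k"
proof -
  obtain R where "0 < R" and R: "\<And>x. x \<in> \<Omega> \<Longrightarrow> norm x \<le> R"
    using \<open>bounded \<Omega>\<close> by (auto simp: bounded_pos)
  have "1 / (2 * R)\<^sup>2 \<le> \<mu> k" if "dirichlet_eigenbasis \<Omega> \<mu> e" for \<mu> e k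
  proof -
    have ek: "e k \<in> H10 \<Omega>"
      "\<And>v. v \<in> H10 \<Omega> \<Longrightarrow> L2_inner \<Omega> (weak_grad \<Omega> (e k)) (weak_grad \<Omega> v) = \<mu> k * L2_inner \<Omega> (e k) v"
      "L2_inner \<Omega> (e k) (e k) = 1"
      using that by (auto simp: dirichlet_eigenbasis_def dirichlet_eigenpair_def orthonormal_basis_L2_def)
    have "1 = (L2_norm \<Omega> (e k))\<^sup>2"
      using ek(3) by (simp add: L2_norm_sq)
    also have "\<dots> \<le> (2 * R * L2_norm \<Omega> (weak_grad \<Omega> (e k)))\<^sup>2"
      using \<open>0 < R\<close> by (intro power_mono Poincare_inequality_H10 ek(1) assms(2) R L2_norm_nonneg) auto
    also have "\<dots> = (2 * R)\<^sup>2 * \<mu> k"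
      unfolding power_mult_distrib[of "2 * R"] L2_norm_sq using ek(2)[OF ek(1)] ek(3) by simp
    finally show ?thesis
      using \<open>0 < R\<close> by (simp add: field_simps)
  qed
  then show ?thesis
    using \<open>0 < R\<close> by (intro that[of "1 / (2 * R)\<^sup>2"]) auto
qed

subsection \<open>Termwise differentiation of Dirichlet series\<close>

lemma power_div_fact_le_exp:
  assumes "0 \<le> (x::real)"
  shows "x ^ j / fact j \<le> exp x"
  using sum_le_suminf[OF summable_exp_generic[of x], of "{j}"] assms
  by (simp add: exp_def divide_inverse_commute)

text \<open>One term of the exponential series bounds the power by
  \<open>exp (s1 * \<bar>L\<bar>)\<close>. For \<open>L \<ge> 0\<close> the decay
  \<open>exp (- s * L)\<close> absorbs this factor; for negative \<open>L\<close>, which arises from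
  eigenvalues below 1, the absolute value is at most \<open>\<bar>l\<bar>\<close>.\<close>

lemma power_mult_exp_le:
  fixes L :: real
  assumes "0 < s1" "s1 \<le> s" "s \<le> s2" "l \<le> L"
  shows "\<bar>L\<bar> ^ j * exp (- s * L) \<le> fact j / s1 ^ j * exp ((s1 + s2) * \<bar>l\<bar>)"
proof -
  have "\<bar>L\<bar> ^ j \<le> fact j / s1 ^ j * exp (s1 * \<bar>L\<bar>)"
    using power_div_fact_le_exp[of "s1 * \<bar>L\<bar>" j] assms(1) by (simp add: field_simps power_mult_distrib)
  then have "\<bar>L\<bar> ^ j * exp (- s * L) \<le> fact j / s1 ^ j * exp (s1 * \<bar>L\<bar>) * exp (- s * L)"
    by (rule mult_right_mono) simp
  also have "\<dots> = fact j / s1 ^ j * exp (s1 * \<bar>L\<bar> - s * L)"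
    by (simp add: exp_diff exp_minus divide_inverse)
  also have "\<dots> \<le> fact j / s1 ^ j * exp ((s1 + s2) * \<bar>l\<bar>)"
  proof -
    have "s1 * \<bar>L\<bar> - s * L \<le> (s1 + s2) * \<bar>l\<bar>"
    proof (cases "0 \<le> L")
      case True
      then have "s1 * L \<le> s * L"
        using assms by (intro mult_right_mono) auto
      moreover have "0 \<le> (s1 + s2) * \<bar>l\<bar>"
        using assms by simp
      ultimately show ?thesis
        using True by simp
    next
      case False
      then have "(s1 + s) * \<bar>L\<bar> \<le> (s1 + s2) * \<bar>l\<bar>"
        using assms by (intro mult_mono) auto
      then show ?thesis
        using False by (simp add: algebra_simps)
    qed
    then show ?thesis
      using assms(1) by (intro mult_left_mono) auto
  qed
  finally show ?thesis .
qed

text \<open>The arithmetic-geometric mean inequality, termwise. If both sums of squares are at most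
  \<open>\<epsilon>\<^sup>2\<close>, so is the sum of the products.\<close>

lemma
  fixes x y :: "nat \<Rightarrow> real"
  assumes x: "summable (\<lambda>k. (x k)\<^sup>2)" and y: "summable (\<lambda>k. (y k)\<^sup>2)"
  shows summable_abs_mult_squares: "summable (\<lambda>k. \<bar>x k * y k\<bar>)"
    and suminf_abs_mult_squares_le:
      "(\<Sum>k. \<bar>x k * y k\<bar>) \<le> ((\<Sum>k. (x k)\<^sup>2) + (\<Sum>k. (y k)\<^sup>2)) / 2"
proof -
  have le: "\<bar>x k * y k\<bar> \<le> ((x k)\<^sup>2 + (y k)\<^sup>2) / 2" for k
    using sum_squares_bound[of "\<bar>x k\<bar>" "\<bar>y k\<bar>"] by (simp add: abs_mult)
  have sum: "summable (\<lambda>k. ((x k)\<^sup>2 + (y k)\<^sup>2) / 2)"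
    using x y by (intro summable_divide summable_add)
  show *: "summable (\<lambda>k. \<bar>x k * y k\<bar>)"
    by (rule summable_comparison_test'[OF sum]) (use le in simp)
  have "(\<Sum>k. \<bar>x k * y k\<bar>) \<le> (\<Sum>k. ((x k)\<^sup>2 + (y k)\<^sup>2) / 2)"
    by (rule suminf_le[OF le * sum])
  then show "(\<Sum>k. \<bar>x k * y k\<bar>) \<le> ((\<Sum>k. (x k)\<^sup>2) + (\<Sum>k. (y k)\<^sup>2)) / 2"
    using x y by (simp add: suminf_divide suminf_add summable_add)
qed

text \<open>With \<open>L k = ln (\<mu> k)\<close> this is the \<open>j\<close>-th derivative of \<open>\<Sum>k. c k * \<mu> k powr (- s)\<close>.\<close>

definition dirichlet_series :: "(nat \<Rightarrow> real) \<Rightarrow> (nat \<Rightarrow> real) \<Rightarrow> nat \<Rightarrow> real \<Rightarrow> real" where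
  "dirichlet_series c L j s = (\<Sum>k. c k * (- L k) ^ j * exp (- s * L k))"

lemma abs_dirichlet_series_term_le:
  fixes L :: real
  assumes "0 < s1" "s1 \<le> s" "s \<le> s2" "l \<le> L"
  shows "\<bar>c * (- L) ^ j * exp (- s * L)\<bar> \<le> \<bar>c\<bar> * (fact j / s1 ^ j * exp ((s1 + s2) * \<bar>l\<bar>))"
  using mult_left_mono[OF power_mult_exp_le[OF assms, of j] abs_ge_zero[of c]]
  by (simp add: abs_mult power_abs mult.assoc)

text \<open>The majorant depends on \<open>L\<close> only through its lower bound \<open>l\<close>,
  hence later on the spectrum only through the Poincare constant.\<close>

lemma
  assumes "summable (\<lambda>k. \<bar>c k\<bar>)" "\<And>k. l \<le> L k" "0 < s1" "s1 \<le> s" "s \<le> s2"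
  shows summable_dirichlet_series: "summable (\<lambda>k. c k * (- L k) ^ j * exp (- s * L k))"
    and abs_dirichlet_series_le:
      "\<bar>dirichlet_series c L j s\<bar> \<le> (\<Sum>k. \<bar>c k\<bar>) * (fact j / s1 ^ j * exp ((s1 + s2) * \<bar>l\<bar>))"
proof -
  let ?K = "fact j / s1 ^ j * exp ((s1 + s2) * \<bar>l\<bar>)"
  have le: "norm (c k * (- L k) ^ j * exp (- s * L k)) \<le> \<bar>c k\<bar> * ?K" for k
    using abs_dirichlet_series_term_le[OF assms(3-5,2)] by simp
  have sum: "summable (\<lambda>k. \<bar>c k\<bar> * ?K)"
    using assms(1) by (rule summable_mult2)
  show "summable (\<lambda>k. c k * (- L k) ^ j * exp (- s * L k))"
    by (rule summable_comparison_test'[OF sum le])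
  have "norm (dirichlet_series c L j s) \<le> (\<Sum>k. \<bar>c k\<bar> * ?K)"
    unfolding dirichlet_series_def by (rule norm_suminf_le[OF le sum])
  then show "\<bar>dirichlet_series c L j s\<bar> \<le> (\<Sum>k. \<bar>c k\<bar>) * ?K"
    by (simp only: real_norm_def suminf_mult2[OF assms(1), symmetric])
qed

lemma has_real_derivative_dirichlet_series:
  assumes c: "summable (\<lambda>k. \<bar>c k\<bar>)" and l: "\<And>k. l \<le> L k" and "0 < s"
  shows "(dirichlet_series c L j has_real_derivative dirichlet_series c L (Suc j) s) (at s)"
  unfolding dirichlet_series_def[abs_def]
proof (rule has_field_derivative_series')
  \<comment> \<open>Differentiation is local: on this compact neighbourhood of \<open>s\<close>,
    which stays away from 0, the majorants for the order \<open>Suc j\<close> are uniform, as the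
    Weierstrass test requires.\<close>
  let ?S = "{s/2..2 * s}"
  show "convex ?S" by simp
  show "((\<lambda>s. c k * (- L k) ^ j * exp (- s * L k)) has_real_derivative
      c k * (- L k) ^ Suc j * exp (- x * L k)) (at x within ?S)" for k x
    by (auto intro!: derivative_eq_intros)
  show "uniformly_convergent_on ?S (\<lambda>n x. \<Sum>k<n. c k * (- L k) ^ Suc j * exp (- x * L k))"
  proof (rule Weierstrass_m_test')
    show "norm (c k * (- L k) ^ Suc j * exp (- x * L k))
        \<le> \<bar>c k\<bar> * (fact (Suc j) / (s/2) ^ Suc j * exp ((s/2 + 2 * s) * \<bar>l\<bar>))" if "x \<in> ?S" for k x
      unfolding real_norm_def using that \<open>0 < s\<close> l by (intro abs_dirichlet_series_term_le) auto
    show "summable (\<lambda>k. \<bar>c k\<bar> * (fact (Suc j) / (s/2) ^ Suc j * exp ((s/2 + 2 * s) * \<bar>l\<bar>)))"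
      using c by (rule summable_mult2)
  qed
  show "s \<in> ?S" using \<open>0 < s\<close> by simp
  show "summable (\<lambda>k. c k * (- L k) ^ j * exp (- s * L k))"
    by (rule summable_dirichlet_series[OF c l \<open>0 < s\<close> order_refl order_refl])
  show "s \<in> interior ?S" using \<open>0 < s\<close> by simp
qed

section \<open>One-variable calculus near a minimum\<close>

lemma C2_onI:
  fixes h :: "real \<Rightarrow> real"
  assumes "open I"
    and h': "\<And>s. s \<in> I \<Longrightarrow> (h has_real_derivative h' s) (at s)"
    and h'': "\<And>s. s \<in> I \<Longrightarrow> (h' has_real_derivative h'' s) (at s)"
    and cont: "continuous_on I h''"
  shows "C2_on I h" and "\<And>s. s \<in> I \<Longrightarrow> deriv (deriv h) s = h'' s"
proof -
  have d1: "deriv h s = h' s" if "s \<in> I" for s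
    using h'[OF that] by (rule DERIV_imp_deriv)
  have d2: "(deriv h has_real_derivative h'' s) (at s)" if "s \<in> I" for s
    by (rule has_field_derivative_transform_within_open[OF h''[OF that] \<open>open I\<close> that]) (simp add: d1)
  then show d3: "\<And>s. s \<in> I \<Longrightarrow> deriv (deriv h) s = h'' s"
    by (rule DERIV_imp_deriv)
  have "continuous_on I (deriv (deriv h))"
    using cont by (simp add: d3 cong: continuous_on_cong)
  then show "C2_on I h"
    using h' d2 unfolding C2_on_def by (auto simp: real_differentiable_def)
qed

lemma C2_on_DERIV:
  assumes "C2_on I h" "s \<in> I"
  shows "(h has_real_derivative deriv h s) (at s)"
    and "(deriv h has_real_derivative deriv (deriv h) s) (at s)"
  using assms by (auto simp: C2_on_def DERIV_deriv_iff_real_differentiable)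

text \<open>Dividing the monotonicity inequality by the square of \<open>s - t\<close> bounds the
  difference quotients of \<open>h'\<close> below by \<open>\<xi>\<close>; the bound passes to their
  limit.\<close>

lemma second_derivative_ge_of_strongly_monotone_derivative:
  fixes h :: "real \<Rightarrow> real"
  assumes "open I" "t \<in> I" and h': "(h' has_real_derivative D) (at t)"
    and mono: "\<And>s. s \<in> I \<Longrightarrow> (h' s - h' t) * (s - t) \<ge> \<xi> * \<bar>s - t\<bar>\<^sup>2"
  shows "\<xi> \<le> D"
proof (rule tendsto_lowerbound)
  show "((\<lambda>s. (h' s - h' t) / (s - t)) \<longlongrightarrow> D) (at t)"
    using h' by (simp add: has_field_derivative_iff)
  have "\<forall>\<^sub>F s in at t. s \<in> I \<and> s \<noteq> t"
    using assms(1,2) by (auto simp: eventually_at_topological)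
  then show "\<forall>\<^sub>F s in at t. \<xi> \<le> (h' s - h' t) / (s - t)"
  proof eventually_elim
    case (elim s)
    have "(h' s - h' t) / (s - t) = (h' s - h' t) * (s - t) / \<bar>s - t\<bar>\<^sup>2"
      using elim by (simp add: power2_eq_square)
    moreover have "\<xi> \<le> (h' s - h' t) * (s - t) / \<bar>s - t\<bar>\<^sup>2"
      using mono[of s] elim by (subst pos_le_divide_eq) auto
    ultimately show ?case by simp
  qed
qed simp

text \<open>By continuity the second derivative exceeds \<open>\<theta> / 2\<close> near
  \<open>t\<close>. The mean value theorem for \<open>deriv J\<close> gives the first inequality,
  and Taylor's formula, with vanishing first-order term, the second.\<close>

lemma quadratic_growth_at_minimum:
  fixes J :: "real \<Rightarrow> real"
  assumes "open I" "C2_on I J" "t \<in> I" and min: "\<And>s. s \<in> I \<Longrightarrow> J t \<le> J s"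
    and "0 < \<theta>" "\<theta> \<le> deriv (deriv J) t"
  shows "\<exists>\<delta>>0. (\<forall>s\<in>I \<inter> {t - \<delta><..<t + \<delta>}.
      (deriv J s - deriv J t) * (s - t) \<ge> \<theta> / 2 * \<bar>s - t\<bar>\<^sup>2 \<and>
      J s \<ge> J t + \<theta> / 4 * \<bar>s - t\<bar>\<^sup>2) \<and>
    local_minimum_on I J t \<and>
    (\<forall>r\<in>{t - \<delta><..<t + \<delta>} \<inter> I. local_minimum_on I J r \<longrightarrow> r = t)"
proof -
  note J' = C2_on_DERIV[OF assms(2)]
  \<comment> \<open>Stated for any local minimum \<open>r\<close>, as it serves both
    \<open>t\<close> and the competitors in the uniqueness claim.\<close>
  have critical: "deriv J r = 0" if r: "local_minimum_on I J r" for r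
  proof -
    obtain \<eta> where \<eta>: "\<eta> > 0" "\<And>s. s \<in> I \<Longrightarrow> \<bar>s - r\<bar> < \<eta> \<Longrightarrow> J r \<le> J s" and "r \<in> I"
      using r by (auto simp: local_minimum_on_def)
    obtain \<rho> where \<rho>: "\<rho> > 0" "\<And>y. dist y r < \<rho> \<Longrightarrow> y \<in> I"
      using \<open>open I\<close> \<open>r \<in> I\<close> by (auto simp: open_dist)
    show ?thesis
      using \<eta> \<rho> by (intro DERIV_local_min[OF J'(1)[OF \<open>r \<in> I\<close>], of "min \<eta> \<rho>"])
        (auto simp: dist_real_def abs_minus_commute)
  qed
  have t_min: "local_minimum_on I J t"
    using min \<open>t \<in> I\<close> by (auto simp: local_minimum_on_def intro: exI[of _ 1])
  have t0: "deriv J t = 0"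
    by (rule critical[OF t_min])
  have "isCont (deriv (deriv J)) t"
    using assms(1-3) by (simp add: C2_on_def continuous_on_eq_continuous_at)
  then have "\<forall>\<^sub>F s in nhds t. \<theta> / 2 < deriv (deriv J) s"
    using assms(5,6) by (intro order_tendstoD(1)[of _ "deriv (deriv J) t"])
      (auto simp: isCont_def tendsto_at_iff_tendsto_nhds)
  moreover have "\<forall>\<^sub>F s in nhds t. s \<in> I"
    using assms(1,3) by (rule eventually_nhds_in_open)
  ultimately have "\<forall>\<^sub>F s in nhds t. \<theta> / 2 < deriv (deriv J) s \<and> s \<in> I"
    by (rule eventually_conj)
  then obtain \<delta> where "\<delta> > 0"
    and \<delta>: "\<And>s. \<bar>s - t\<bar> < \<delta> \<Longrightarrow> \<theta> / 2 < deriv (deriv J) s" "\<And>s. \<bar>s - t\<bar> < \<delta> \<Longrightarrow> s \<in> I"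
    unfolding eventually_nhds_metric dist_real_def by blast
  have mono: "(deriv J s - deriv J t) * (s - t) \<ge> \<theta> / 2 * \<bar>s - t\<bar>\<^sup>2"
    and growth: "J s \<ge> J t + \<theta> / 4 * \<bar>s - t\<bar>\<^sup>2" if s: "\<bar>s - t\<bar> < \<delta>" for s
  proof -
    have "(deriv J s - deriv J t) * (s - t) \<ge> \<theta> / 2 * \<bar>s - t\<bar>\<^sup>2 \<and> J s \<ge> J t + \<theta> / 4 * \<bar>s - t\<bar>\<^sup>2"
    proof (cases "s = t")
      case False
      \<comment> \<open>The closed interval between \<open>s\<close> and \<open>t\<close>, whichever
        is larger.\<close>
      define c d where "c = min s t" and "d = max s t"
      have in_I: "x \<in> I" "\<theta> / 2 < deriv (deriv J) x" if "c \<le> x" "x \<le> d" for x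
      proof -
        have "\<bar>x - t\<bar> < \<delta>"
          using that s by (auto simp: c_def d_def min_def max_def split: if_splits)
        then show "x \<in> I" "\<theta> / 2 < deriv (deriv J) x"
          using \<delta> by auto
      qed
      have bounds: "c \<le> t" "t \<le> d" "c \<le> s" "s \<le> d"
        by (auto simp: c_def d_def)
      define D where "D m = (deriv ^^ m) J" for m
      have D: "D 0 = J" "D (Suc 0) = deriv J" "D 2 = deriv (deriv J)"
        by (auto simp: D_def numeral_2_eq_2)
      have "\<exists>z. (if s < t then s < z \<and> z < t else t < z \<and> z < s) \<and>
          J s = (\<Sum>m<2. D m t / fact m * (s - t) ^ m) + D 2 z / fact 2 * (s - t) ^ 2"
      proof (rule Taylor[where a = c and b = d])
        show "\<forall>m x. m < 2 \<and> c \<le> x \<and> x \<le> d \<longrightarrow> (D m has_real_derivative D (Suc m) x) (at x)"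
          using J' in_I(1) by (auto simp: D_def less_2_cases_iff)
      qed (use False bounds D in auto)
      then obtain z where "if s < t then s < z \<and> z < t else t < z \<and> z < s"
        and Taylor: "J s = (\<Sum>m<2. D m t / fact m * (s - t) ^ m) + D 2 z / fact 2 * (s - t)\<^sup>2"
        by blast
      then have z: "c \<le> z" "z \<le> d"
        by (auto simp: c_def d_def split: if_splits)
      \<comment> \<open>The first-order term drops out by \<open>t0\<close>; the factor 1/2 left
        over turns \<open>\<theta> / 2\<close> into \<open>\<theta> / 4\<close>.\<close>
      have J_eq: "J s = J t + D 2 z / 2 * (s - t)\<^sup>2"
        using Taylor by (simp add: D t0 lessThan_nat_numeral)
      have "\<theta> / 4 * (s - t)\<^sup>2 \<le> D 2 z / 2 * (s - t)\<^sup>2"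
        using in_I(2)[OF z] D by (intro mult_right_mono) auto
      then have *: "J s \<ge> J t + \<theta> / 4 * \<bar>s - t\<bar>\<^sup>2"
        using J_eq by simp
      have "c < d"
        using False by (auto simp: c_def d_def)
      then obtain y where y: "c < y" "y < d" "deriv J d - deriv J c = (d - c) * deriv (deriv J) y"
        using MVT2[of c d "deriv J" "deriv (deriv J)"] J'(2) in_I(1) by blast
      then have "deriv J s - deriv J t = deriv (deriv J) y * (s - t)"
        by (auto simp: c_def d_def min_def max_def algebra_simps split: if_splits)
      then have "(deriv J s - deriv J t) * (s - t) = deriv (deriv J) y * (s - t)\<^sup>2"
        by (simp add: power2_eq_square)
      moreover have "\<theta> / 2 * (s - t)\<^sup>2 \<le> deriv (deriv J) y * (s - t)\<^sup>2"
        using in_I(2)[of y] y by (intro mult_right_mono) auto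
      ultimately show ?thesis
        using * by simp
    qed simp
    then show "(deriv J s - deriv J t) * (s - t) \<ge> \<theta> / 2 * \<bar>s - t\<bar>\<^sup>2"
      "J s \<ge> J t + \<theta> / 4 * \<bar>s - t\<bar>\<^sup>2" by auto
  qed
  \<comment> \<open>Both derivatives vanish, so \<open>mono\<close> leaves no room for a positive
    distance between \<open>r\<close> and \<open>t\<close>.\<close>
  have unique: "r = t" if "\<bar>r - t\<bar> < \<delta>" "local_minimum_on I J r" for r
    using mono[OF that(1)] critical[OF that(2)] t0 \<open>0 < \<theta>\<close> by (simp add: mult_le_0_iff)
  have abs: "\<bar>s - t\<bar> < \<delta>" if "s \<in> {t - \<delta><..<t + \<delta>}" for s
    using that by auto
  show ?thesis
    using \<open>\<delta> > 0\<close> mono growth unique t_min abs by (intro exI[of _ \<delta>]) blast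
qed

subsection \<open>The reduced cost\<close>

text \<open>The state has Fourier coefficients
  \<open>\<mu> k powr (- s) * L2_inner \<Omega> f (e k)\<close>. Expanding the square and applying
  Parseval to the quadratic and the mixed term gives the two series.\<close>

lemma reduced_cost_eq_dirichlet_series:
  assumes e: "orthonormal_basis_L2 \<Omega> e" and fin: "finite_measure (lebesgue_on \<Omega>)"
    and f: "f \<in> L2 \<Omega>" and u\<^sub>d: "u\<^sub>d \<in> L2 \<Omega>" and "0 < m" and m: "\<And>k. m \<le> \<mu> k" and "0 < s"
  shows "reduced_cost \<Omega> \<mu> e \<phi> f u\<^sub>d s =
    1/2 * dirichlet_series (\<lambda>k. (L2_inner \<Omega> f (e k))\<^sup>2) (\<lambda>k. ln (\<mu> k)) 0 (2 * s)
    - dirichlet_series (\<lambda>k. L2_inner \<Omega> f (e k) * L2_inner \<Omega> u\<^sub>d (e k)) (\<lambda>k. ln (\<mu> k)) 0 s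
    + 1/2 * (L2_norm \<Omega> u\<^sub>d)\<^sup>2 + \<phi> s"
proof -
  define c where "c k = \<mu> k powr (- s) * L2_inner \<Omega> f (e k)" for k
  have \<mu>: "0 < \<mu> k" "ln m \<le> ln (\<mu> k)" for k
    using \<open>0 < m\<close> m[of k] by auto
  have powr: "\<mu> k powr (- s) = exp (- s * ln (\<mu> k))" for k
    using \<mu>(1)[of k] by (simp add: powr_def)
  \<comment> \<open>Squaring doubles the exponent, which is why the quadratic part is evaluated at
    \<open>2 * s\<close>.\<close>
  have sq: "(c k)\<^sup>2 = (L2_inner \<Omega> f (e k))\<^sup>2 * (- ln (\<mu> k)) ^ 0 * exp (- (2 * s) * ln (\<mu> k))" for k
    by (simp add: c_def powr power2_eq_square exp_add[symmetric])
  have "summable (\<lambda>k. \<bar>(L2_inner \<Omega> f (e k))\<^sup>2\<bar>)"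
    using sums_summable[OF orthonormal_basis_L2_Parseval[OF e f f]] by (simp add: power2_eq_square)
  then have "summable (\<lambda>k. (c k)\<^sup>2)"
    unfolding sq using \<open>0 < s\<close> \<mu>(2) by (intro summable_dirichlet_series[of _ "ln m" _ "2 * s" _ "2 * s"]) auto
  then obtain u where "L2_sums \<Omega> (\<lambda>k x. c k * e k x) u"
    using orthonormal_basis_L2_Riesz_Fischer[OF e fin] by blast
  then have S: "L2_sums \<Omega> (\<lambda>k x. c k * e k x) (control_to_state \<Omega> \<mu> e f s)" (is "L2_sums _ _ ?S")
    unfolding control_to_state_def c_def by (rule someI[of "L2_sums \<Omega> _"])
  then have SL2: "?S \<in> L2 \<Omega>"
    by (simp add: L2_sums_def)
  have SS: "L2_inner \<Omega> ?S ?S = dirichlet_series (\<lambda>k. (L2_inner \<Omega> f (e k))\<^sup>2) (\<lambda>k. ln (\<mu> k)) 0 (2 * s)"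
    using orthonormal_basis_L2_Parseval[OF e SL2 SL2] sq
    by (simp add: L2_sums_coefficient[OF e S] dirichlet_series_def sums_iff power2_eq_square)
  have Su: "L2_inner \<Omega> ?S u\<^sub>d
      = dirichlet_series (\<lambda>k. L2_inner \<Omega> f (e k) * L2_inner \<Omega> u\<^sub>d (e k)) (\<lambda>k. ln (\<mu> k)) 0 s"
    using orthonormal_basis_L2_Parseval[OF e SL2 u\<^sub>d]
    by (simp add: L2_sums_coefficient[OF e S] dirichlet_series_def sums_iff c_def powr mult_ac)
  have "(L2_norm \<Omega> (\<lambda>x. ?S x - u\<^sub>d x))\<^sup>2 = L2_inner \<Omega> ?S ?S - 2 * L2_inner \<Omega> ?S u\<^sub>d + (L2_norm \<Omega> u\<^sub>d)\<^sup>2"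
    using L2_inner_add_scaled[OF SL2 u\<^sub>d, of "-1"] by (simp add: L2_norm_sq)
  then show ?thesis
    unfolding reduced_cost_def SS Su by (simp add: algebra_simps)
qed

text \<open>Two termwise differentiations. The chain rule at \<open>2 * s\<close> contributes a
  factor 2 each time, turning the coefficient 1/2 of the first series into 1 and then 2.\<close>

lemma reduced_cost_C2_on:
  assumes e: "orthonormal_basis_L2 \<Omega> e" and fin: "finite_measure (lebesgue_on \<Omega>)"
    and f: "f \<in> L2 \<Omega>" and u\<^sub>d: "u\<^sub>d \<in> L2 \<Omega>" and "0 < m" and m: "\<And>k. m \<le> \<mu> k"
    and I: "open I" "I \<subseteq> {0<..}" and \<phi>: "C2_on I \<phi>"
  shows "C2_on I (reduced_cost \<Omega> \<mu> e \<phi> f u\<^sub>d)" (is "C2_on I ?J")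
    and "s \<in> I \<Longrightarrow> deriv (deriv (reduced_cost \<Omega> \<mu> e \<phi> f u\<^sub>d)) s =
      2 * dirichlet_series (\<lambda>k. (L2_inner \<Omega> f (e k))\<^sup>2) (\<lambda>k. ln (\<mu> k)) 2 (2 * s)
      - dirichlet_series (\<lambda>k. L2_inner \<Omega> f (e k) * L2_inner \<Omega> u\<^sub>d (e k)) (\<lambda>k. ln (\<mu> k)) 2 s
      + deriv (deriv \<phi>) s"
proof -
  let ?L = "\<lambda>k. ln (\<mu> k)"
  define p where "p k = L2_inner \<Omega> f (e k) * L2_inner \<Omega> u\<^sub>d (e k)" for k
  define q where "q k = (L2_inner \<Omega> f (e k))\<^sup>2" for k
  have l: "ln m \<le> ?L k" for k
    using \<open>0 < m\<close> m[of k] by (intro ln_mono) auto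
  have sf: "summable (\<lambda>k. (L2_inner \<Omega> f (e k))\<^sup>2)" and sd: "summable (\<lambda>k. (L2_inner \<Omega> u\<^sub>d (e k))\<^sup>2)"
    using sums_summable[OF orthonormal_basis_L2_Parseval[OF e f f]]
      sums_summable[OF orthonormal_basis_L2_Parseval[OF e u\<^sub>d u\<^sub>d]] by (simp_all add: power2_eq_square)
  have q: "summable (\<lambda>k. \<bar>q k\<bar>)"
    using sf by (simp add: q_def)
  have p: "summable (\<lambda>k. \<bar>p k\<bar>)"
    unfolding p_def by (rule summable_abs_mult_squares[OF sf sd])
  \<comment> \<open>The chain-rule form lets the derivative rules handle the argument
    \<open>2 * s\<close>.\<close>
  note D[derivative_intros] =
    DERIV_chain2[OF has_real_derivative_dirichlet_series[OF q l]]
    DERIV_chain2[OF has_real_derivative_dirichlet_series[OF p l]]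
  have pos: "0 < s" if "s \<in> I" for s
    using that I(2) by auto
  define F where "F s = 1/2 * dirichlet_series q ?L 0 (2 * s) - dirichlet_series p ?L 0 s
    + 1/2 * (L2_norm \<Omega> u\<^sub>d)\<^sup>2 + \<phi> s" for s
  define F' where "F' s = dirichlet_series q ?L 1 (2 * s) - dirichlet_series p ?L 1 s + deriv \<phi> s" for s
  define F'' where "F'' s = 2 * dirichlet_series q ?L 2 (2 * s) - dirichlet_series p ?L 2 s
    + deriv (deriv \<phi>) s" for s
  have J_eq: "?J s = F s" if "s \<in> I" for s
    unfolding F_def p_def q_def
    by (rule reduced_cost_eq_dirichlet_series[OF e fin f u\<^sub>d \<open>0 < m\<close> m pos[OF that]])
  have F: "(F has_real_derivative F' s) (at s)" if "s \<in> I" for s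
    unfolding F_def[abs_def] F'_def using pos[OF that]
    by (auto intro!: derivative_eq_intros C2_on_DERIV(1)[OF \<phi> that])
  then have J: "(?J has_real_derivative F' s) (at s)" if "s \<in> I" for s
    using has_field_derivative_transform_within_open[OF F[OF that] I(1) that] J_eq by force
  have J': "(F' has_real_derivative F'' s) (at s)" if "s \<in> I" for s
    unfolding F'_def[abs_def] F''_def using pos[OF that]
    by (auto intro!: derivative_eq_intros C2_on_DERIV(2)[OF \<phi> that] simp: numeral_2_eq_2)
  have "continuous_on I F''"
  proof -
    \<comment> \<open>The series of order 2 is continuous because it is itself
      differentiable.\<close>
    have "continuous_on {0<..} (dirichlet_series q ?L 2)" "continuous_on {0<..} (dirichlet_series p ?L 2)"
      using DERIV_isCont[OF has_real_derivative_dirichlet_series[OF q l]]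
        DERIV_isCont[OF has_real_derivative_dirichlet_series[OF p l]]
      by (auto simp: continuous_on_eq_continuous_at)
    then show ?thesis
      unfolding F''_def[abs_def] using \<phi> pos
      by (intro continuous_intros) (auto simp: C2_on_def intro: continuous_on_compose2)
  qed
  note C2 = C2_onI[of I ?J F' F'', OF I(1) J J' this, simplified]
  show "C2_on I ?J"
    by (rule C2(1))
  show "deriv (deriv ?J) s = 2 * dirichlet_series (\<lambda>k. (L2_inner \<Omega> f (e k))\<^sup>2) ?L 2 (2 * s)
      - dirichlet_series (\<lambda>k. L2_inner \<Omega> f (e k) * L2_inner \<Omega> u\<^sub>d (e k)) ?L 2 s
      + deriv (deriv \<phi>) s" if "s \<in> I"
    using C2(2)[OF that] by (simp add: F''_def p_def[abs_def] q_def[abs_def])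
qed

section \<open>Uniform choice of the smallness threshold and the second-order condition\<close>

theorem corollary3p6:
  fixes \<Omega> :: "(real ^ 'n) set" and a b \<xi> :: real and \<phi> :: "real \<Rightarrow> real"
  assumes "convex_polytopal_domain \<Omega>"
    and "0 \<le> a" and "a < b" and "b \<le> 1"
    and "C2_on {a<..<b} \<phi>"
    and "\<And>s. s \<in> {a<..<b} \<Longrightarrow> 0 \<le> \<phi> s"
    and "filterlim \<phi> at_top (at_right a)"
    and "filterlim \<phi> at_top (at_left b)"
    and "0 < \<xi>"
    and "\<And>s1 s2. s1 \<in> {a<..<b} \<Longrightarrow> s2 \<in> {a<..<b} \<Longrightarrow>
           (deriv \<phi> s1 - deriv \<phi> s2) * (s1 - s2) \<ge> \<xi> * \<bar>s1 - s2\<bar>\<^sup>2"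
  shows "\<exists>\<epsilon>>0. \<forall>(\<mu> :: nat \<Rightarrow> real) e f u\<^sub>d.
    dirichlet_eigenbasis \<Omega> \<mu> e \<longrightarrow>
    f \<in> L2 \<Omega> \<longrightarrow> u\<^sub>d \<in> L2 \<Omega> \<longrightarrow> L2_norm \<Omega> f \<le> \<epsilon> \<longrightarrow> L2_norm \<Omega> u\<^sub>d \<le> \<epsilon> \<longrightarrow>
    (let J = reduced_cost \<Omega> \<mu> e \<phi> f u\<^sub>d in
      C2_on {a<..<b} J \<and>
      (\<forall>t\<in>{a<..<b}. (\<forall>s\<in>{a<..<b}. J t \<le> J s) \<longrightarrow>
        (\<exists>\<theta>>0. deriv (deriv J) t \<ge> \<theta> \<and>
          (\<exists>\<delta>>0.
            (\<forall>s\<in>{a<..<b} \<inter> {t - \<delta><..<t + \<delta>}.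
              (deriv J s - deriv J t) * (s - t) \<ge> \<theta> / 2 * \<bar>s - t\<bar>\<^sup>2 \<and>
              J s \<ge> J t + \<theta> / 4 * \<bar>s - t\<bar>\<^sup>2) \<and>
            local_minimum_on {a<..<b} J t \<and>
            (\<forall>r\<in>{t - \<delta><..<t + \<delta>} \<inter> {a<..<b}.
              local_minimum_on {a<..<b} J r \<longrightarrow> r = t)))))"
proof -
  have \<phi>: "C2_on {a<..<b} \<phi>" and \<xi>: "0 < \<xi>"
    and strong: "\<And>s1 s2. s1 \<in> {a<..<b} \<Longrightarrow> s2 \<in> {a<..<b} \<Longrightarrow>
      (deriv \<phi> s1 - deriv \<phi> s2) * (s1 - s2) \<ge> \<xi> * \<bar>s1 - s2\<bar>\<^sup>2"
    by (fact assms)+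
  have \<Omega>: "bounded \<Omega>" "open \<Omega>" "\<Omega> \<in> sets lebesgue"
    using assms(1) by (auto simp: convex_polytopal_domain_def)
  have fin: "finite_measure (lebesgue_on \<Omega>)"
    using \<Omega> by (intro finite_measure_lebesgue_on bounded_set_imp_lmeasurable)
  obtain m where "0 < m"
    and m: "\<And>\<mu> e k. dirichlet_eigenbasis \<Omega> \<mu> e \<Longrightarrow> m \<le> \<mu> k"
    using dirichlet_eigenbasis_bounded_below[OF \<Omega>(1,3)] by blast
  define s0 where "s0 = (a + b) / 2"
  have s0: "s0 \<in> {a<..<b}" "0 < s0"
    using assms(2,3) by (auto simp: s0_def)
  \<comment> \<open>Bounds both order-zero series at \<open>s0\<close> when the coefficient sums are
    at most 1: the quadratic one, taken at \<open>2 * s0\<close>, gives exactly this exponent and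
    the mixed one half of it.\<close>
  define E where "E = exp (4 * s0 * \<bar>ln m\<bar>)"
  \<comment> \<open>An upper bound for the cost at \<open>s0\<close> whenever both norms are at most
    1. It depends on neither \<open>f\<close> nor \<open>u\<^sub>d\<close>.\<close>
  define M where "M = \<phi> s0 + 2 * E + 1"
  have "\<forall>\<^sub>F s in at_right a. M < \<phi> s"
    using assms(7) by (simp add: filterlim_at_top_dense)
  then obtain s1 where "a < s1" and s1: "\<And>s. a < s \<Longrightarrow> s < s1 \<Longrightarrow> M < \<phi> s"
    by (auto simp: eventually_at_right_field)
  \<comment> \<open>The majorant constant of order 2 on \<open>s1 \<le> t \<le> 1\<close>, a range
    that will contain every optimal \<open>t\<close> because \<open>b \<le> 1\<close>.\<close>
  define K where "K = fact 2 / s1 ^ 2 * exp ((s1 + 1) * \<bar>ln m\<bar>)"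
  have "0 < s1"
    using \<open>0 \<le> a\<close> \<open>a < s1\<close> by simp
  then have "0 \<le> K"
    by (simp add: K_def)
  \<comment> \<open>The cap 1 gives \<open>\<epsilon>\<^sup>2 \<le> \<epsilon>\<close> and validates
    \<open>M\<close>; the second entry makes \<open>\<epsilon>\<^sup>2 * K\<close> at most half of
    \<open>\<xi>\<close>. Writing \<open>K + 1\<close> keeps the denominator positive.\<close>
  define \<epsilon> where "\<epsilon> = min 1 (\<xi> / (2 * (K + 1)))"
  have \<epsilon>: "0 < \<epsilon>" "\<epsilon> \<le> 1" "\<epsilon>\<^sup>2 \<le> 1"
    using \<xi> \<open>0 \<le> K\<close> by (auto simp: \<epsilon>_def power_le_one)
  have \<epsilon>K: "\<epsilon>\<^sup>2 * K \<le> \<xi> / 2"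
  proof -
    have "\<epsilon>\<^sup>2 * K \<le> \<epsilon> * K"
      using \<epsilon> \<open>0 \<le> K\<close> by (intro mult_right_mono) (auto simp: power2_eq_square mult_left_le)
    also have "\<dots> \<le> \<xi> / (2 * (K + 1)) * (K + 1)"
      using \<epsilon> \<open>0 \<le> K\<close> by (intro mult_mono) (auto simp: \<epsilon>_def)
    also have "\<dots> = \<xi> / 2"
      using \<open>0 \<le> K\<close> by (simp add: divide_simps)
    finally show ?thesis .
  qed
  have I: "open {a<..<b}" "{a<..<b} \<subseteq> {0<..}"
    using \<open>0 \<le> a\<close> by auto
  show ?thesis
    unfolding Let_def
  proof (rule exI[of _ \<epsilon>], intro conjI allI impI ballI \<epsilon>(1))
    fix \<mu> :: "nat \<Rightarrow> real" and e and f u\<^sub>d :: "real ^ 'n \<Rightarrow> real"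
    assume basis: "dirichlet_eigenbasis \<Omega> \<mu> e" and f: "f \<in> L2 \<Omega>" and u\<^sub>d: "u\<^sub>d \<in> L2 \<Omega>"
      and small: "L2_norm \<Omega> f \<le> \<epsilon>" "L2_norm \<Omega> u\<^sub>d \<le> \<epsilon>"
    let ?J = "reduced_cost \<Omega> \<mu> e \<phi> f u\<^sub>d"
    let ?L = "\<lambda>k. ln (\<mu> k)"
    let ?q = "\<lambda>k. (L2_inner \<Omega> f (e k))\<^sup>2"
    let ?p = "\<lambda>k. L2_inner \<Omega> f (e k) * L2_inner \<Omega> u\<^sub>d (e k)"
    have e: "orthonormal_basis_L2 \<Omega> e"
      using basis by (simp add: dirichlet_eigenbasis_def)
    have \<mu>: "m \<le> \<mu> k" for k
      by (rule m[OF basis])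
    have l: "ln m \<le> ?L k" for k
      using \<open>0 < m\<close> \<mu>[of k] by (intro ln_mono) auto
    have qf: "?q sums (L2_norm \<Omega> f)\<^sup>2"
      using orthonormal_basis_L2_Parseval[OF e f f] unfolding L2_norm_sq by (simp add: power2_eq_square)
    have qd: "(\<lambda>k. (L2_inner \<Omega> u\<^sub>d (e k))\<^sup>2) sums (L2_norm \<Omega> u\<^sub>d)\<^sup>2"
      using orthonormal_basis_L2_Parseval[OF e u\<^sub>d u\<^sub>d] unfolding L2_norm_sq by (simp add: power2_eq_square)
    have norms: "(L2_norm \<Omega> f)\<^sup>2 \<le> \<epsilon>\<^sup>2" "(L2_norm \<Omega> u\<^sub>d)\<^sup>2 \<le> \<epsilon>\<^sup>2"
      using small by (auto intro: power_mono L2_norm_nonneg)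
    have q: "summable (\<lambda>k. \<bar>?q k\<bar>)" "(\<Sum>k. \<bar>?q k\<bar>) \<le> \<epsilon>\<^sup>2"
      using qf norms by (auto simp: sums_iff)
    have p: "summable (\<lambda>k. \<bar>?p k\<bar>)" "(\<Sum>k. \<bar>?p k\<bar>) \<le> \<epsilon>\<^sup>2"
      using summable_abs_mult_squares[OF sums_summable[OF qf] sums_summable[OF qd]]
        suminf_abs_mult_squares_le[OF sums_summable[OF qf] sums_summable[OF qd]]
        norms sums_unique[OF qf] sums_unique[OF qd] by auto
    note C2 = reduced_cost_C2_on[OF e fin f u\<^sub>d \<open>0 < m\<close> \<mu> I \<phi>]
    show C2_J: "C2_on {a<..<b} ?J"
      by (rule C2(1))
    fix t assume t: "t \<in> {a<..<b}" and t_min: "\<forall>s\<in>{a<..<b}. ?J t \<le> ?J s"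
    \<comment> \<open>Below \<open>s1\<close> the term \<open>\<phi> t\<close> alone would exceed
      \<open>M\<close>, hence the cost at \<open>s0\<close>, contradicting optimality.\<close>
    have "s1 \<le> t"
    proof (rule ccontr)
      assume "\<not> s1 \<le> t"
      then have "M < \<phi> t"
        using s1 t by auto
      also have "\<phi> t \<le> ?J t"
        by (simp add: reduced_cost_def)
      also have "\<dots> \<le> ?J s0"
        using t_min s0 by blast
      also have "\<dots> = 1/2 * dirichlet_series ?q ?L 0 (2 * s0) - dirichlet_series ?p ?L 0 s0
          + 1/2 * (L2_norm \<Omega> u\<^sub>d)\<^sup>2 + \<phi> s0"
        by (rule reduced_cost_eq_dirichlet_series[OF e fin f u\<^sub>d \<open>0 < m\<close> \<mu> s0(2)])
      also have "\<dots> \<le> M"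
      proof -
        have "\<bar>dirichlet_series ?q ?L 0 (2 * s0)\<bar> \<le> (\<Sum>k. \<bar>?q k\<bar>) * E"
          using abs_dirichlet_series_le[where L = ?L and s = "2 * s0" and j = 0, OF q(1) l _ order_refl order_refl] s0(2)
          by (simp add: E_def)
        also have "\<dots> \<le> 1 * E"
          using q(2) \<epsilon>(3) by (intro mult_right_mono) (auto simp: E_def)
        finally have 1: "\<bar>dirichlet_series ?q ?L 0 (2 * s0)\<bar> \<le> E" by simp
        have "\<bar>dirichlet_series ?p ?L 0 s0\<bar> \<le> (\<Sum>k. \<bar>?p k\<bar>) * exp ((s0 + s0) * \<bar>ln m\<bar>)"
          using abs_dirichlet_series_le[where L = ?L and j = 0, OF p(1) l s0(2) order_refl order_refl] by simp
        also have "\<dots> \<le> 1 * E"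
          using p(2) \<epsilon>(3) s0(2) suminf_nonneg[OF p(1)] unfolding E_def
          by (intro mult_mono) (auto intro!: mult_right_mono)
        finally have 2: "\<bar>dirichlet_series ?p ?L 0 s0\<bar> \<le> E" by simp
        show ?thesis
          using 1 2 norms(2) \<epsilon>(3) unfolding M_def abs_le_iff by linarith
      qed
      finally show False by simp
    qed
    have "0 < t"
      using t I(2) by auto
    \<comment> \<open>All terms are squares times exponentials, so among the two series only the
      mixed one can lower the second derivative.\<close>
    have "0 \<le> dirichlet_series ?q ?L 2 (2 * t)"
      unfolding dirichlet_series_def using \<open>0 < t\<close>
      by (intro suminf_nonneg summable_dirichlet_series[where L = ?L, OF q(1) l _ order_refl order_refl]) auto
    moreover have "\<bar>dirichlet_series ?p ?L 2 t\<bar> \<le> \<xi> / 2"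
    proof -
      have "\<bar>dirichlet_series ?p ?L 2 t\<bar> \<le> (\<Sum>k. \<bar>?p k\<bar>) * K"
        unfolding K_def using t \<open>b \<le> 1\<close>
        by (intro abs_dirichlet_series_le[where L = ?L, OF p(1) l \<open>0 < s1\<close> \<open>s1 \<le> t\<close>]) auto
      also have "\<dots> \<le> \<epsilon>\<^sup>2 * K"
        using p(2) \<open>0 \<le> K\<close> by (rule mult_right_mono)
      finally show ?thesis
        using \<epsilon>K by simp
    qed
    moreover have "\<xi> \<le> deriv (deriv \<phi>) t"
      by (rule second_derivative_ge_of_strongly_monotone_derivative
          [OF I(1) t C2_on_DERIV(2)[OF \<phi> t] strong[OF _ t]])
    ultimately have "\<xi> / 2 \<le> deriv (deriv ?J) t"
      using C2(2)[OF t] by (simp add: abs_le_iff)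
    then show "\<exists>\<theta>>0. deriv (deriv ?J) t \<ge> \<theta> \<and>
        (\<exists>\<delta>>0.
          (\<forall>s\<in>{a<..<b} \<inter> {t - \<delta><..<t + \<delta>}.
            (deriv ?J s - deriv ?J t) * (s - t) \<ge> \<theta> / 2 * \<bar>s - t\<bar>\<^sup>2 \<and>
            ?J s \<ge> ?J t + \<theta> / 4 * \<bar>s - t\<bar>\<^sup>2) \<and>
          local_minimum_on {a<..<b} ?J t \<and>
          (\<forall>r\<in>{t - \<delta><..<t + \<delta>} \<inter> {a<..<b}. local_minimum_on {a<..<b} ?J r \<longrightarrow> r = t))"
      using \<xi> t_min quadratic_growth_at_minimum[OF I(1) C2_J t, of "\<xi> / 2"]
      by (intro exI[of _ "\<xi> / 2"]) auto
  qed
qed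

end
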